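(* Let $n\geq 3$ and let $K(n,n)$ be the complete bipartite graph with both partite sets of size $n$. Then: (i) for every edge-coloring of $K(n,n)$ with three colors in which every vertex has color degree $3$, the vertex set of $K(n,n)$ can be partitioned into (covered by) at most three vertex-disjoint monochromatic trees; and (ii) there exists an edge-coloring of $K(n,n)$ with three colors in which every vertex has color degree $3$ such that the vertex set cannot be covered by fewer than three vertex-disjoint monochromatic trees. In other words, $t_3(K(n,n))=3$ when the tree partition number is taken over $3$-edge-colorings in which every vertex has color degree $3$.
   Context: A monochromatic tree in an edge-colored graph is a subgraph that is a tree all of whose edges have the same color; a single (isolated) vertex counts as a monochromatic tree. The color degree of a vertex is the number of distinct colors appearing on the edges incident with it. The monochromatic tree partition number $t_r(G)$ of a graph $G$ (with respect to a class of $r$-edge-colorings) is the minimum integer $k$ such that for every such $r$-edge-coloring of $G$, the vertices of $G$ can be covered by at most $k$ vertex-disjoint monochromatic trees. *)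

theory Defs
  imports Main
begin

section \<open>Finite simple graphs\<close>

text \<open>A graph is a pair of a vertex set and a set of edges, an edge being a two-element set of
  vertices. The notion \<open>tree\<close> of the AFP entry \<open>Graph_Theory\<close> is not usable here: it forbids directed
  cycles only, so that a symmetric digraph with at least one edge is never a tree there.\<close>

type_synonym 'a graph = "'a set \<times> 'a set set"

definition verts :: "'a graph \<Rightarrow> 'a set" where
  "verts G = fst G"

definition edges :: "'a graph \<Rightarrow> 'a set set" where
  "edges G = snd G"

definition simple_graph :: "'a graph \<Rightarrow> bool" where
  "simple_graph G \<longleftrightarrow> finite (verts G) \<and>
     (\<forall>e\<in>edges G. \<exists>u\<in>verts G. \<exists>v\<in>verts G. u \<noteq> v \<and> e = {u, v})"

definition subgraph :: "'a graph \<Rightarrow> 'a graph \<Rightarrow> bool" where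
  "subgraph H G \<longleftrightarrow>
     simple_graph H \<and> simple_graph G \<and> verts H \<subseteq> verts G \<and> edges H \<subseteq> edges G"

definition is_walk :: "'a graph \<Rightarrow> 'a list \<Rightarrow> bool" where
  "is_walk G p \<longleftrightarrow>
     p \<noteq> [] \<and> set p \<subseteq> verts G \<and> successively (\<lambda>u v. {u, v} \<in> edges G) p"

definition connected_graph :: "'a graph \<Rightarrow> bool" where
  "connected_graph G \<longleftrightarrow> verts G \<noteq> {} \<and>
     (\<forall>u\<in>verts G. \<forall>v\<in>verts G. \<exists>p. is_walk G p \<and> hd p = u \<and> last p = v)"

text \<open>A cycle is listed without repeating its initial vertex.\<close>

definition is_cycle :: "'a graph \<Rightarrow> 'a list \<Rightarrow> bool" where
  "is_cycle G p \<longleftrightarrow>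
     is_walk G p \<and> distinct p \<and> length p \<ge> 3 \<and> {last p, hd p} \<in> edges G"

definition is_tree :: "'a graph \<Rightarrow> bool" where
  "is_tree G \<longleftrightarrow> simple_graph G \<and> connected_graph G \<and> (\<nexists>p. is_cycle G p)"

definition complete_bipartite :: "nat \<Rightarrow> nat \<Rightarrow> (nat + nat) graph" where
  "complete_bipartite m n =
     (Inl ` {..<m} \<union> Inr ` {..<n}, {{Inl i, Inr j} | i j. i < m \<and> j < n})"


section \<open>Edge colorings and monochromatic trees\<close>

text \<open>Colors are natural numbers. The values of a coloring outside the edge set are irrelevant.\<close>

definition edge_coloring :: "nat \<Rightarrow> 'a graph \<Rightarrow> ('a set \<Rightarrow> nat) \<Rightarrow> bool" where
  "edge_coloring r G c \<longleftrightarrow> (\<forall>e\<in>edges G. c e < r)"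

definition color_degree :: "'a graph \<Rightarrow> ('a set \<Rightarrow> nat) \<Rightarrow> 'a \<Rightarrow> nat" where
  "color_degree G c v = card (c ` {e \<in> edges G. v \<in> e})"

definition mono_tree :: "'a graph \<Rightarrow> ('a set \<Rightarrow> nat) \<Rightarrow> 'a graph \<Rightarrow> bool" where
  "mono_tree G c T \<longleftrightarrow> subgraph T G \<and> is_tree T \<and> (\<exists>k. \<forall>e\<in>edges T. c e = k)"

definition mono_tree_partition ::
    "'a graph \<Rightarrow> ('a set \<Rightarrow> nat) \<Rightarrow> 'a graph set \<Rightarrow> bool" where
  "mono_tree_partition G c \<T> \<longleftrightarrow> finite \<T> \<and> (\<forall>T\<in>\<T>. mono_tree G c T) \<and>
     (\<forall>S\<in>\<T>. \<forall>T\<in>\<T>. S \<noteq> T \<longrightarrow> verts S \<inter> verts T = {}) \<and>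
     (\<Union>T\<in>\<T>. verts T) = verts G"

text \<open>The parameter \<open>C\<close> is the class of colorings over which the number is taken.\<close>

definition tree_partition_number :: "'a graph \<Rightarrow> ('a set \<Rightarrow> nat) set \<Rightarrow> nat" where
  "tree_partition_number G C =
     (LEAST k. \<forall>c\<in>C. \<exists>\<T>. mono_tree_partition G c \<T> \<and> card \<T> \<le> k)"

definition full_degree_colorings :: "nat \<Rightarrow> 'a graph \<Rightarrow> ('a set \<Rightarrow> nat) set" where
  "full_degree_colorings r G =
     {c. edge_coloring r G c \<and> (\<forall>v\<in>verts G. color_degree G c v = r)}"

end

theory Submission
  imports Defs
begin

text \<open>Upper bound. If a color has at most three components, these components are the partition, so let every color have at
  least four. Labelling a vertex with its three components, the two ends of an edge share a label. A combinatorial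
  analysis of such labellings shows that there are two trees, or that there are components, one for each color, such
  that each vertex lies in at least two of them. In the latter case let \<open>A0\<close>, \<open>B0\<close> be the vertices on either side
  lying in all three, and fix a color \<open>k\<close>. A tree of color \<open>k\<close> takes most of the component, and its complement
  \<open>X \<union> Y\<close> is covered by two stars: one around a vertex \<open>q\<close> sending a single color to \<open>X\<close>, one around a vertex \<open>p\<close> sending
  a single color to \<open>Y\<close>. This fails only if removing \<open>q\<close> or \<open>p\<close> separates many vertices of \<open>A0 \<union> B0\<close>, and these
  have almost no edges of color \<open>k\<close> outside \<open>A0 \<union> B0\<close>. Since such sets for different colors are disjoint,
  all three colors failing contradicts the equality of the sizes of the two sides.\<close>

section \<open>Connected sets and components\<close>

text \<open>Color degree three acts through components: as every vertex has an edge of every color,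
  each component meets both sides, so four components of a color yield four labels on each side.
  Once every vertex misses at most one of the three components, an edge between vertices missing
  different components can only have the remaining color; this is where vertices sending a single
  color to \<open>X\<close> or \<open>Y\<close> come from. The obstacle is that such a vertex may be
  a cut vertex of the component of color \<open>k\<close>. Failure is then expensive: up to
  exchanging the sides, the separated part has to realise every subset of \<open>Y\<close> without
  one fixed point as a color pattern, which takes at least 2^(|Y| - 1) vertices of
  \<open>A0\<close>. Balance bounds the difference of the sizes of \<open>A0\<close> and
  \<open>B0\<close> only by the total size of the three sets \<open>Y\<close>, and the exponential
  wins over this linear quantity from |Y| = 3 on, the least size that four labels guarantee.\<close>

text \<open>Connectivity is expressed by cuts, which avoids walks until the trees are built.\<close>

definition conn :: "('v \<Rightarrow> 'v \<Rightarrow> bool) \<Rightarrow> 'v set \<Rightarrow> bool" where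
  "conn E S \<longleftrightarrow> S \<noteq> {} \<and> (\<forall>W\<subseteq>S. W \<noteq> {} \<longrightarrow> W \<noteq> S \<longrightarrow> (\<exists>w\<in>W. \<exists>v\<in>S - W. E w v))"

definition component :: "('v \<Rightarrow> 'v \<Rightarrow> bool) \<Rightarrow> 'v set \<Rightarrow> 'v \<Rightarrow> 'v set" where
  "component E S u = \<Union>{K. K \<subseteq> S \<and> u \<in> K \<and> conn E K}"

lemma connD: "conn E S \<Longrightarrow> W \<subseteq> S \<Longrightarrow> W \<noteq> {} \<Longrightarrow> W \<noteq> S \<Longrightarrow> \<exists>w\<in>W. \<exists>v\<in>S - W. E w v"
  unfolding conn_def by blast

lemma conn_singleton: "conn E {u}"
  unfolding conn_def by blast

lemma conn_Union:
  assumes "\<K> \<noteq> {}" and "\<And>K. K \<in> \<K> \<Longrightarrow> conn E K \<and> u \<in> K"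
  shows "conn E (\<Union>\<K>)"
  unfolding conn_def
proof (intro conjI allI impI)
  show "\<Union>\<K> \<noteq> {}" using assms by blast
  fix W assume W: "W \<subseteq> \<Union>\<K>" "W \<noteq> {}" "W \<noteq> \<Union>\<K>"
  obtain K where K: "K \<in> \<K>" "W \<inter> K \<noteq> {}" "W \<inter> K \<noteq> K"
  proof (cases "u \<in> W")
    case True
    obtain v where v: "v \<in> \<Union>\<K>" "v \<notin> W" using W by blast
    then obtain K where K: "K \<in> \<K>" "v \<in> K" by blast
    moreover have "u \<in> K" using K(1) assms(2) by blast
    ultimately show ?thesis using that[of K] True v by blast
  next
    case False
    obtain v where v: "v \<in> W" using W(2) by blast
    then obtain K where K: "K \<in> \<K>" "v \<in> K" using W(1) by blast
    moreover have "u \<in> K" using K(1) assms(2) by blast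
    ultimately show ?thesis using that[of K] False v by blast
  qed
  then have "\<exists>w\<in>W \<inter> K. \<exists>v\<in>K - W \<inter> K. E w v"
    using assms(2)[of K] connD[of E K "W \<inter> K"] by blast
  then show "\<exists>w\<in>W. \<exists>v\<in>\<Union>\<K> - W. E w v" using K(1) by blast
qed

lemma conn_Un:
  assumes "conn E S" "conn E T" "S \<inter> T \<noteq> {}"
  shows "conn E (S \<union> T)"
proof -
  obtain u where "u \<in> S \<inter> T" using assms(3) by blast
  then have "conn E (\<Union>{S, T})" using assms by (intro conn_Union) auto
  then show ?thesis by simp
qed

lemma conn_attach:
  assumes "symp E" "conn E S" and T: "\<And>t. t \<in> T \<Longrightarrow> t \<notin> S \<Longrightarrow> \<exists>s\<in>S. E s t"
  shows "conn E (S \<union> T)"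
  unfolding conn_def
proof (intro conjI allI impI)
  show "S \<union> T \<noteq> {}" using assms(2) by (auto simp: conn_def)
  fix W assume W: "W \<subseteq> S \<union> T" "W \<noteq> {}" "W \<noteq> S \<union> T"
  consider "W \<inter> S = {}" | "S \<subseteq> W" | "W \<inter> S \<noteq> {}" "W \<inter> S \<noteq> S" by blast
  then show "\<exists>w\<in>W. \<exists>v\<in>S \<union> T - W. E w v"
  proof cases
    case 1
    then obtain t where t: "t \<in> W" "t \<in> T" "t \<notin> S" using W by blast
    then show ?thesis using T[of t] 1 \<open>symp E\<close> by (blast dest: sympD)
  next
    case 2
    then obtain t where t: "t \<notin> W" "t \<in> T" "t \<notin> S" using W by blast
    then show ?thesis using T[of t] 2 by blast
  next
    case 3
    then show ?thesis using connD[OF assms(2), of "W \<inter> S"] by blast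
  qed
qed

lemma conn_join:
  assumes "symp E" "conn E S" "conn E T" "s \<in> S" "t \<in> T" "E s t"
  shows "conn E (S \<union> T)"
proof -
  have "conn E (S \<union> {t})" using assms by (intro conn_attach) auto
  then have "conn E ((S \<union> {t}) \<union> T)" by (rule conn_Un) (use assms in auto)
  moreover have "(S \<union> {t}) \<union> T = S \<union> T" using assms by blast
  ultimately show ?thesis by simp
qed

lemma component_subset: "component E S u \<subseteq> S"
  unfolding component_def by blast

lemma component_max: "conn E K \<Longrightarrow> K \<subseteq> S \<Longrightarrow> u \<in> K \<Longrightarrow> K \<subseteq> component E S u"
  unfolding component_def by (rule Union_upper) simp

lemma component_refl: "u \<in> S \<Longrightarrow> u \<in> component E S u"
  using component_max[OF conn_singleton[of E u], of S u] by simp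

lemma component_conn: "u \<in> S \<Longrightarrow> conn E (component E S u)"
  unfolding component_def
proof (rule conn_Union[where u = u])
  assume "u \<in> S"
  then show "{K. K \<subseteq> S \<and> u \<in> K \<and> conn E K} \<noteq> {}"
    using conn_singleton[of E u] by (intro ex_in_conv[THEN iffD1] exI[of _ "{u}"]) simp
qed simp

lemma component_closed:
  assumes "symp E" "u \<in> S" "v \<in> component E S u" "w \<in> S" "E v w"
  shows "w \<in> component E S u"
proof -
  have "conn E (component E S u \<union> {w})"
    using assms component_conn by (intro conn_attach) auto
  then show ?thesis
    using component_max[of E "component E S u \<union> {w}" S u] component_subset[of E S u]
      component_refl[OF assms(2)] assms(4) by blast
qed

text \<open>The component of \<open>p\<close> in S - {a} has no edge to the rest of S - {a}, so an
  edge by which S leaves it can only end in \<open>a\<close>.\<close>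

lemma conn_neighbour_component:
  assumes "symp E" "conn E S" "a \<in> S" "p \<in> S" "a \<noteq> p"
  shows "\<exists>w\<in>component E (S - {a}) p. E a w"
proof -
  let ?W = "component E (S - {a}) p"
  have sub: "?W \<subseteq> S - {a}" by (rule component_subset)
  have p: "p \<in> ?W" using assms by (intro component_refl) auto
  obtain w v where wv: "w \<in> ?W" "v \<in> S - ?W" "E w v"
    using connD[OF assms(2), of ?W] sub p assms(3) by blast
  have "v = a"
  proof (rule ccontr)
    assume "v \<noteq> a"
    then have "v \<in> ?W"
      using component_closed[OF assms(1), of p "S - {a}" w v] wv assms by blast
    then show False using wv by blast
  qed
  then show ?thesis using wv assms(1) by (blast dest: sympD)
qed

text \<open>Every piece left by the deletion of \<open>q\<close> hangs on \<open>q\<close>, so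
  taking one piece away cannot disconnect the others. In terms of cuts: an edge of S leaving a set
  that avoids \<open>q\<close> cannot enter the removed closed piece; a set containing
  \<open>q\<close> is handled by its complement.\<close>

lemma conn_minus_component:
  assumes "symp E" "conn E S" "q \<in> S" "p \<in> S - {q}"
  shows "conn E (S - component E (S - {q}) p)"
proof -
  let ?W = "component E (S - {q}) p" and ?T = "S - component E (S - {q}) p"
  have sub: "?W \<subseteq> S - {q}" by (rule component_subset)
  have key: "\<exists>u\<in>U. \<exists>v\<in>?T - U. E u v" if U: "U \<subseteq> ?T" "U \<noteq> {}" "q \<notin> U" for U
  proof -
    obtain u v where uv: "u \<in> U" "v \<in> S - U" "E u v"
      using connD[OF assms(2), of U] U assms(3) by blast
    have "v \<notin> ?W"
    proof
      assume "v \<in> ?W"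
      then have "u \<in> ?W"
        using component_closed[OF assms(1), of p "S - {q}" v u] uv U assms by (blast dest: sympD)
      then show False using U uv by blast
    qed
    then show ?thesis using uv by blast
  qed
  show ?thesis
    unfolding conn_def
  proof (intro conjI allI impI)
    show "?T \<noteq> {}" using sub assms(3) by blast
    fix U assume U: "U \<subseteq> ?T" "U \<noteq> {}" "U \<noteq> ?T"
    show "\<exists>u\<in>U. \<exists>v\<in>?T - U. E u v"
    proof (cases "q \<in> U")
      case False
      then show ?thesis using key U by blast
    next
      case True
      have "\<exists>u\<in>?T - U. \<exists>v\<in>?T - (?T - U). E u v" using key[of "?T - U"] U True by blast
      then show ?thesis using assms(1) by (blast dest: sympD)
    qed
  qed
qed

section \<open>Monochromatic sets in colored bipartite graphs\<close>

text \<open>Every vertex of \<open>N\<close> hangs on one of the connected sets \<open>H1\<close>, \<open>H2\<close>. Growing a connected set from \<open>H1\<close>,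
  a vertex of \<open>N\<close> has to be spent only to reach \<open>H2\<close> or a vertex of \<open>T\<close>.\<close>

lemma conn_few_connectors:
  fixes E :: "'v \<Rightarrow> 'v \<Rightarrow> bool"
  assumes sym: "symp E" and W: "conn E W" "finite W" and N: "N \<subseteq> W"
    and indep: "\<And>u v. u \<in> N \<Longrightarrow> v \<in> N \<Longrightarrow> \<not> E u v"
    and H1: "conn E H1" "H1 \<subseteq> W - N" and H2: "conn E H2" "H2 \<subseteq> W - N"
    and N_H: "\<And>u. u \<in> N \<Longrightarrow> \<exists>h\<in>H1 \<union> H2. E h u"
    and T: "\<And>u v. u \<in> N \<Longrightarrow> v \<in> W - N \<Longrightarrow> E u v \<Longrightarrow> v \<in> T \<or> v \<in> H1 \<union> H2 \<or> (\<exists>h\<in>H1 \<union> H2. E h v)"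
    and "finite T"
  shows "\<exists>N'\<subseteq>N. card N' \<le> card T + 1 \<and> (\<forall>L\<subseteq>N - N'. conn E (W - L))"
proof -
  \<comment> \<open>A budget: each vertex of N in U is paid for by a vertex of T in U, and a single
    extra one by having absorbed H2. A largest U within the budget turns out to contain W -
    N.\<close>
  define good where "good U \<longleftrightarrow> U \<subseteq> W \<and> conn E U \<and> H1 \<subseteq> U \<and>
    card (U \<inter> N) \<le> card (U \<inter> T) + (if H2 \<subseteq> U then 1 else 0)" for U
  have "good H1"
  proof -
    have "H1 \<inter> N = {}" using H1 by blast
    then show ?thesis using H1 by (auto simp: good_def)
  qed
  moreover have "\<forall>U. good U \<longrightarrow> card U < Suc (card W)"
    using W(2) by (auto simp: good_def less_Suc_eq_le intro: card_mono)
  ultimately obtain U where U: "good U" and max: "\<And>U'. good U' \<Longrightarrow> card U' \<le> card U"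
    using ex_has_greatest_nat[of good H1 card "Suc (card W)"] by blast
  have UW: "U \<subseteq> W" and connU: "conn E U" and H1U: "H1 \<subseteq> U"
    and cardU: "card (U \<inter> N) \<le> card (U \<inter> T) + (if H2 \<subseteq> U then 1 else 0)"
    using U by (auto simp: good_def)
  have finU: "finite U" using UW W(2) finite_subset by blast
  have max': False if "U \<subseteq> U'" "U' \<subseteq> W" "v \<in> U'" "v \<notin> U" "conn E U'"
    "card (U' \<inter> N) \<le> card (U' \<inter> T) + (if H2 \<subseteq> U' then 1 else 0)" for U' v
  proof -
    have "good U'" using that H1U by (auto simp: good_def)
    then have "card U' \<le> card U" by (rule max)
    moreover have "card U < card U'"
      using that W(2) by (intro psubset_card_mono) (auto dest: finite_subset)
    ultimately show False by simp
  qed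
  have mono: "card (U \<inter> T) + (if H2 \<subseteq> U then 1 else 0) \<le> card (U' \<inter> T) + (if H2 \<subseteq> U' then 1 else 0)"
    if "U \<subseteq> U'" for U'
  proof -
    have "card (U \<inter> T) \<le> card (U' \<inter> T)"
      using that \<open>finite T\<close> by (intro card_mono) auto
    then show ?thesis using that by auto
  qed
  have no_edge: "\<not> E u v" if "u \<in> U" "v \<in> W - U - N" for u v
  proof
    assume "E u v"
    have "conn E (U \<union> {v})" using that \<open>E u v\<close> connU sym by (intro conn_attach) auto
    moreover have eq: "(U \<union> {v}) \<inter> N = U \<inter> N" using that by blast
    have "card ((U \<union> {v}) \<inter> N) \<le> card ((U \<union> {v}) \<inter> T) + (if H2 \<subseteq> U \<union> {v} then 1 else 0)"
      unfolding eq by (rule order_trans[OF cardU mono]) blast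
    ultimately show False
      using max'[of "U \<union> {v}" v] that UW by blast
  qed
  have H2U: "H2 \<subseteq> U" if "H2 \<inter> U \<noteq> {}"
  proof (rule ccontr)
    assume "\<not> H2 \<subseteq> U"
    then obtain v where v: "v \<in> H2" "v \<notin> U" by blast
    have "conn E (U \<union> H2)" using that connU H2 by (intro conn_Un) auto
    moreover have eq: "(U \<union> H2) \<inter> N = U \<inter> N" using H2 by blast
    have "card ((U \<union> H2) \<inter> N) \<le> card ((U \<union> H2) \<inter> T) + (if H2 \<subseteq> U \<union> H2 then 1 else 0)"
      unfolding eq by (rule order_trans[OF cardU mono]) blast
    ultimately show False
      using max'[of "U \<union> H2" v] v UW H2 by blast
  qed
  have WN: "W - N \<subseteq> U"
  proof (rule ccontr)
    assume "\<not> W - N \<subseteq> U"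
    \<comment> \<open>All neighbours in N are added at once, so an edge leaving U' starts at some
      \<open>u\<close> in N adjacent to U and ends outside N. Only this \<open>u\<close> has to be
      spent to reach \<open>v\<close>.\<close>
    define U' where "U' = U \<union> {n \<in> N. \<exists>u\<in>U. E u n}"
    have "U' \<subseteq> W" "U' \<noteq> W" "U' \<noteq> {}"
      using \<open>\<not> W - N \<subseteq> U\<close> UW N connU by (auto simp: U'_def conn_def)
    then obtain u v where uv: "u \<in> U'" "v \<in> W" "v \<notin> U'" "E u v"
      using connD[OF W(1)] by (metis DiffE)
    have v: "v \<notin> U" using uv by (auto simp: U'_def)
    have "u \<notin> U"
    proof
      assume "u \<in> U"
      then have "v \<notin> N" using uv by (auto simp: U'_def)
      then show False using no_edge[OF \<open>u \<in> U\<close>, of v] uv v by blast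
    qed
    then obtain m where u: "u \<in> N" "m \<in> U" "E m u" using uv by (auto simp: U'_def)
    have vN: "v \<in> W - N" using indep u(1) uv by blast
    have conn2: "conn E (U \<union> {u} \<union> {v})"
      using u uv connU sym by (intro conn_attach) auto
    have cardN: "card ((U \<union> {u}) \<inter> N) = card (U \<inter> N) + 1"
      using u(1) \<open>u \<notin> U\<close> finU by (simp add: Int_insert_left)
    \<comment> \<open>Reaching \<open>h\<close> lets U absorb the whole of H2, and the extra unit of
      the budget pays for \<open>u\<close>.\<close>
    have H2_case: False if h: "h \<in> H2" "h = v \<or> E h v" for h
    proof -
      have disj: "H2 \<inter> U = {}"
      proof (rule ccontr)
        assume "H2 \<inter> U \<noteq> {}"
        then have "h \<in> U" using H2U h by blast
        then show False using h v no_edge[of h v] vN by blast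
      qed
      have "conn E (U \<union> {u} \<union> {v} \<union> H2)"
      proof (cases "h = v")
        case True
        then show ?thesis using h by (intro conn_Un[OF conn2 H2(1)]) auto
      next
        case False
        then have "E v h" using h sym by (blast dest: sympD)
        then show ?thesis using conn_join[OF sym conn2 H2(1), of v h] h by blast
      qed
      moreover have "card ((U \<union> {u} \<union> {v} \<union> H2) \<inter> N)
          \<le> card ((U \<union> {u} \<union> {v} \<union> H2) \<inter> T) + (if H2 \<subseteq> U \<union> {u} \<union> {v} \<union> H2 then 1 else 0)"
      proof -
        have eq: "(U \<union> {u} \<union> {v} \<union> H2) \<inter> N = (U \<union> {u}) \<inter> N" using vN H2 by blast
        have "card (U \<inter> T) \<le> card ((U \<union> {u} \<union> {v} \<union> H2) \<inter> T)"
          using \<open>finite T\<close> by (intro card_mono) auto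
        moreover have "\<not> H2 \<subseteq> U" using disj H2 by (auto simp: conn_def)
        moreover have "H2 \<subseteq> U \<union> {u} \<union> {v} \<union> H2" by blast
        ultimately show ?thesis unfolding eq cardN using cardU by simp
      qed
      moreover have "U \<union> {u} \<union> {v} \<union> H2 \<subseteq> W" using u(1) N UW H2 vN by blast
      ultimately show False
        using max'[of "U \<union> {u} \<union> {v} \<union> H2" v] v by blast
    qed
    consider "v \<in> T" | "v \<in> H1" | h where "h \<in> H1" "E h v" | h where "h \<in> H2" "h = v \<or> E h v"
      using T[of u v] u(1) vN uv(4) by blast
    then show False
    proof cases
      case 1
      have eq: "(U \<union> {u} \<union> {v}) \<inter> N = (U \<union> {u}) \<inter> N" using vN by blast
      have "card (U \<inter> T) + 1 \<le> card ((U \<union> {u} \<union> {v}) \<inter> T)"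
      proof -
        have "card (insert v (U \<inter> T)) \<le> card ((U \<union> {u} \<union> {v}) \<inter> T)"
          using \<open>finite T\<close> 1 by (intro card_mono) auto
        then show ?thesis using v \<open>finite T\<close> by simp
      qed
      moreover have "H2 \<subseteq> U \<Longrightarrow> H2 \<subseteq> U \<union> {u} \<union> {v}" by blast
      ultimately have "card ((U \<union> {u} \<union> {v}) \<inter> N)
          \<le> card ((U \<union> {u} \<union> {v}) \<inter> T) + (if H2 \<subseteq> U \<union> {u} \<union> {v} then 1 else 0)"
        unfolding eq cardN using cardU by (cases "H2 \<subseteq> U") auto
      moreover have "U \<union> {u} \<union> {v} \<subseteq> W" using u(1) N UW vN by blast
      ultimately show False
        using max'[of "U \<union> {u} \<union> {v}" v] v conn2 by blast
    next
      case 2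
      then show False using H1U v by blast
    next
      case 3
      then show False using no_edge[of h v] H1U v vN by blast
    next
      case 4
      then show False using H2_case by blast
    qed
  qed
  have "card (U \<inter> N) \<le> card T + 1"
  proof -
    have "card (U \<inter> T) \<le> card T" using \<open>finite T\<close> by (intro card_mono) auto
    then show ?thesis using cardU by (auto split: if_splits)
  qed
  moreover have "conn E (W - L)" if "L \<subseteq> N - U \<inter> N" for L
  proof -
    have "conn E (U \<union> (N - L))"
    proof (rule conn_attach[OF sym connU])
      fix t assume "t \<in> N - L"
      then obtain h where "h \<in> H1 \<union> H2" "E h t" using N_H[of t] by blast
      then show "\<exists>s\<in>U. E s t" using H1 H2 WN by blast
    qed
    moreover have "U \<union> (N - L) = W - L" using that WN UW N by blast
    ultimately show ?thesis by simp
  qed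
  ultimately show ?thesis by (intro exI[of _ "U \<inter> N"]) auto
qed

section \<open>Colorings of two-sided graphs as symmetric functions of two vertices\<close>

definition adj :: "'v set \<Rightarrow> 'v set \<Rightarrow> ('v \<Rightarrow> 'v \<Rightarrow> nat) \<Rightarrow> nat \<Rightarrow> 'v \<Rightarrow> 'v \<Rightarrow> bool" where
  "adj A B col k u v \<longleftrightarrow> (u \<in> A \<and> v \<in> B \<or> u \<in> B \<and> v \<in> A) \<and> col u v = k"

definition monochromatic :: "'v set \<Rightarrow> 'v set \<Rightarrow> ('v \<Rightarrow> 'v \<Rightarrow> nat) \<Rightarrow> 'v set \<Rightarrow> bool" where
  "monochromatic A B col S \<longleftrightarrow> S = {} \<or> (\<exists>k. conn (adj A B col k) S)"

definition three_parts :: "'v set \<Rightarrow> 'v set \<Rightarrow> ('v \<Rightarrow> 'v \<Rightarrow> nat) \<Rightarrow> bool" where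
  "three_parts A B col \<longleftrightarrow> (\<exists>S T U. A \<union> B = S \<union> T \<union> U \<and> S \<inter> T = {} \<and> S \<inter> U = {} \<and> T \<inter> U = {} \<and>
     monochromatic A B col S \<and> monochromatic A B col T \<and> monochromatic A B col U)"

lemma three_partsI:
  assumes "A \<union> B = S \<union> T \<union> U" "S \<inter> T = {}" "S \<inter> U = {}" "T \<inter> U = {}"
    "monochromatic A B col S" "monochromatic A B col T" "monochromatic A B col U"
  shows "three_parts A B col"
  using assms unfolding three_parts_def by blast

lemma adj_swap: "adj B A col = adj A B col"
  by (auto simp: adj_def fun_eq_iff)

lemma three_parts_swap: "three_parts B A col = three_parts A B col"
  by (simp add: three_parts_def monochromatic_def adj_swap Un_commute)

locale bipartite_coloring =
  fixes A B :: "'v set" and col :: "'v \<Rightarrow> 'v \<Rightarrow> nat"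
  assumes fin_A: "finite A" and fin_B: "finite B" and AB: "A \<inter> B = {}"
    and col_commute: "col u v = col v u"
begin

lemma adj_symp: "symp (adj A B col k)"
  by (rule sympI) (auto simp: adj_def col_commute)

lemma adjI: "a \<in> A \<Longrightarrow> b \<in> B \<Longrightarrow> col a b = k \<Longrightarrow> adj A B col k a b"
  by (simp add: adj_def)

lemma adjI': "a \<in> A \<Longrightarrow> b \<in> B \<Longrightarrow> col a b = k \<Longrightarrow> adj A B col k b a"
  by (simp add: adj_def col_commute)

lemma conn_attach_A:
  assumes "conn (adj A B col k) S" "T \<subseteq> A" "\<And>t. t \<in> T \<Longrightarrow> t \<notin> S \<Longrightarrow> \<exists>s\<in>S \<inter> B. col t s = k"
  shows "conn (adj A B col k) (S \<union> T)"
proof (rule conn_attach[OF adj_symp assms(1)])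
  fix t assume "t \<in> T" "t \<notin> S"
  then show "\<exists>s\<in>S. adj A B col k s t" using assms(2,3) adjI' by blast
qed

lemma conn_attach_B:
  assumes "conn (adj A B col k) S" "T \<subseteq> B" "\<And>t. t \<in> T \<Longrightarrow> t \<notin> S \<Longrightarrow> \<exists>s\<in>S \<inter> A. col s t = k"
  shows "conn (adj A B col k) (S \<union> T)"
proof (rule conn_attach[OF adj_symp assms(1)])
  fix t assume "t \<in> T" "t \<notin> S"
  then show "\<exists>s\<in>S. adj A B col k s t" using assms(2,3) adjI by blast
qed

lemma conn_complete:
  assumes "S \<subseteq> A" "T \<subseteq> B" "S \<noteq> {}" "T \<noteq> {}" "\<And>s t. s \<in> S \<Longrightarrow> t \<in> T \<Longrightarrow> col s t = k"
  shows "conn (adj A B col k) (S \<union> T)"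
proof -
  obtain s where s: "s \<in> S" using assms(3) by blast
  have "conn (adj A B col k) ({s} \<union> T)"
    by (rule conn_attach_B[OF conn_singleton]) (use assms s in blast)+
  then have "conn (adj A B col k) (({s} \<union> T) \<union> S)"
    by (rule conn_attach_A) (use assms s in blast)+
  moreover have "({s} \<union> T) \<union> S = S \<union> T" using s by blast
  ultimately show ?thesis by simp
qed

lemma monochromaticI: "conn (adj A B col k) S \<Longrightarrow> monochromatic A B col S"
  by (auto simp: monochromatic_def)

lemma swap: "bipartite_coloring B A col"
  using fin_A fin_B AB col_commute by unfold_locales auto

end

section \<open>A large component of one color\<close>

text \<open>\<open>A1 \<union> B1\<close> is the vertex set of a component of color \<open>k\<close>, and \<open>X\<close>, \<open>Y\<close> are the parts of its complement.
  A vertex of \<open>A1\<close> (of \<open>B1\<close>) is called full if all its edges to \<open>Y\<close> (to \<open>X\<close>) have the same color;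
  \<open>P\<close>, \<open>P'\<close>, \<open>Q\<close>, \<open>Q'\<close> provide full vertices of both remaining colors.\<close>

locale main_color = bipartite_coloring A B col
  for A B :: "'v set" and col +
  fixes k d d' :: nat and A1 X B1 Y P P' Q Q' :: "'v set"
  assumes A: "A = A1 \<union> X" "A1 \<inter> X = {}" and B: "B = B1 \<union> Y" "B1 \<inter> Y = {}"
    and kd: "k \<noteq> d" "k \<noteq> d'" "d \<noteq> d'"
    and col_AB: "\<And>a b. a \<in> A \<Longrightarrow> b \<in> B \<Longrightarrow> col a b \<in> {k, d, d'}"
    and A1Y: "\<And>a y. a \<in> A1 \<Longrightarrow> y \<in> Y \<Longrightarrow> col a y \<noteq> k"
    and XB1: "\<And>x b. x \<in> X \<Longrightarrow> b \<in> B1 \<Longrightarrow> col x b \<noteq> k"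
    and conn1: "conn (adj A B col k) (A1 \<union> B1)"
    and edge_d: "\<exists>x\<in>X. \<exists>y\<in>Y. col x y = d" and edge_d': "\<exists>x\<in>X. \<exists>y\<in>Y. col x y = d'"
    and P: "P \<subseteq> A1" "P' \<subseteq> A1" "P \<inter> P' = {}" and Q: "Q \<subseteq> B1" "Q' \<subseteq> B1" "Q \<inter> Q' = {}"
    and PY: "\<And>a y. a \<in> P \<Longrightarrow> y \<in> Y \<Longrightarrow> col a y = d" and P'Y: "\<And>a y. a \<in> P' \<Longrightarrow> y \<in> Y \<Longrightarrow> col a y = d'"
    and XQ: "\<And>x b. x \<in> X \<Longrightarrow> b \<in> Q \<Longrightarrow> col x b = d" and XQ': "\<And>x b. x \<in> X \<Longrightarrow> b \<in> Q' \<Longrightarrow> col x b = d'"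
    and PQ': "\<And>a b. a \<in> P \<Longrightarrow> b \<in> Q' \<Longrightarrow> col a b = k" and P'Q: "\<And>a b. a \<in> P' \<Longrightarrow> b \<in> Q \<Longrightarrow> col a b = k"
    and card_X: "card X \<ge> 3" and card_P: "card P \<ge> 3" and card_P': "card P' \<ge> 3"
    and card_Y: "card Y \<ge> 3" and card_Q: "card Q \<ge> 3" and card_Q': "card Q' \<ge> 3"
    and not_three: "\<not> three_parts A B col"
begin

abbreviation E where "E \<equiv> adj A B col k"

definition "A0 = A1 - P - P'"
definition "B0 = B1 - Q - Q'"
text \<open>One edge is tolerated because the deleted full vertex \<open>q\<close> may itself belong
  to Q or Q'; the vertices it separates have no other edge of color \<open>k\<close> into that
  set.\<close>

definition "poor_A = {a \<in> A0. card {b \<in> Q \<union> Q'. col a b = k} \<le> 1}"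
definition "poor_B = {b \<in> B0. card {a \<in> P \<union> P'. col a b = k} \<le> 1}"

lemma X_A: "X \<subseteq> A" "A1 \<subseteq> A" and Y_B: "Y \<subseteq> B" "B1 \<subseteq> B"
  using A B by auto

lemma fin: "finite A1" "finite B1" "finite X" "finite Y" "finite P" "finite P'" "finite Q" "finite Q'"
proof -
  show *: "finite A1" "finite B1" "finite X" "finite Y" using fin_A fin_B A B by auto
  show "finite P" "finite P'" "finite Q" "finite Q'" using * P Q finite_subset by blast+
qed

lemma XY_ne: "X \<noteq> {}" "Y \<noteq> {}"
  using card_X card_Y by auto

lemma A1_B1: "A1 \<inter> B1 = {}"
  using AB X_A Y_B by blast

lemma col_A1Y: "a \<in> A1 \<Longrightarrow> y \<in> Y \<Longrightarrow> col a y = d \<or> col a y = d'"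
  using col_AB[of a y] A1Y[of a y] A B by blast

lemma col_XB1: "x \<in> X \<Longrightarrow> b \<in> B1 \<Longrightarrow> col x b = d \<or> col x b = d'"
  using col_AB[of x b] XB1[of x b] A B by blast

text \<open>The three parts are K, the star of \<open>p\<close> over Y and the star of
  \<open>q\<close> over X. A vertex of A1 left over by K joins the star of \<open>p\<close> through
  Y, one of B1 joins the star of \<open>q\<close> through X. For full \<open>p\<close> and
  \<open>q\<close> the only obstruction is thus a leftover vertex that is full in the wrong
  color.\<close>

lemma full_pair_False:
  assumes p: "p \<in> A1" "\<And>y. y \<in> Y \<Longrightarrow> col p y = cp" and q: "q \<in> B1" "\<And>x. x \<in> X \<Longrightarrow> col x q = cq"
    and K: "K \<subseteq> A1 \<union> B1 - {p, q}" "conn E K"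
    and rest_A: "\<And>a. a \<in> A1 - K - {p} \<Longrightarrow> \<exists>y\<in>Y. col a y = cp"
    and rest_B: "\<And>b. b \<in> B1 - K - {q} \<Longrightarrow> \<exists>x\<in>X. col x b = cq"
  shows False
proof -
  have "conn (adj A B col cp) ({p} \<union> Y)"
    by (rule conn_attach_B[OF conn_singleton]) (use p X_A Y_B in blast)+
  then have "conn (adj A B col cp) ({p} \<union> Y \<union> (A1 - K - {p}))"
    by (rule conn_attach_A) (use rest_A X_A Y_B in blast)+
  then have mA: "monochromatic A B col ({p} \<union> Y \<union> (A1 - K - {p}))"
    by (rule monochromaticI)
  have "conn (adj A B col cq) ({q} \<union> X)"
    by (rule conn_attach_A[OF conn_singleton]) (use q X_A Y_B in blast)+
  then have "conn (adj A B col cq) ({q} \<union> X \<union> (B1 - K - {q}))"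
    by (rule conn_attach_B) (use rest_B X_A Y_B in blast)+
  then have mB: "monochromatic A B col ({q} \<union> X \<union> (B1 - K - {q}))"
    by (rule monochromaticI)
  have "three_parts A B col"
  proof (rule three_partsI[OF _ _ _ _ monochromaticI[OF K(2)] mA mB])
    show "A \<union> B = K \<union> ({p} \<union> Y \<union> (A1 - K - {p})) \<union> ({q} \<union> X \<union> (B1 - K - {q}))"
      using K(1) p(1) q(1) A(1) B(1) by auto
    show "K \<inter> ({p} \<union> Y \<union> (A1 - K - {p})) = {}" "K \<inter> ({q} \<union> X \<union> (B1 - K - {q})) = {}"
      using K(1) A B AB by auto
    show "({p} \<union> Y \<union> (A1 - K - {p})) \<inter> ({q} \<union> X \<union> (B1 - K - {q})) = {}"
      using p(1) q(1) A B AB by auto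
  qed
  then show False using not_three by simp
qed

lemma swap_main: "main_color B A col k d d' B1 Y A1 X Q Q' P P'"
proof -
  interpret sw: bipartite_coloring B A col by (rule swap)
  show ?thesis
  proof unfold_locales
    show "\<And>a b. a \<in> B \<Longrightarrow> b \<in> A \<Longrightarrow> col a b \<in> {k, d, d'}" using col_AB col_commute by metis
    show "\<And>a b. a \<in> Q \<Longrightarrow> b \<in> P' \<Longrightarrow> col a b = k" using P'Q col_commute by metis
    show "\<And>a b. a \<in> Q' \<Longrightarrow> b \<in> P \<Longrightarrow> col a b = k" using PQ' col_commute by metis
    show "\<And>a y. a \<in> B1 \<Longrightarrow> y \<in> X \<Longrightarrow> col a y \<noteq> k" using XB1 col_commute by metis
    show "\<And>a y. a \<in> Y \<Longrightarrow> y \<in> A1 \<Longrightarrow> col a y \<noteq> k" using A1Y col_commute by metis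
    show "conn (adj B A col k) (B1 \<union> A1)" using conn1 by (simp add: adj_swap Un_commute)
    show "\<exists>x\<in>Y. \<exists>y\<in>X. col x y = d" using edge_d col_commute by metis
    show "\<exists>x\<in>Y. \<exists>y\<in>X. col x y = d'" using edge_d' col_commute by metis
    show "\<And>a y. a \<in> Q \<Longrightarrow> y \<in> X \<Longrightarrow> col a y = d" using XQ col_commute by metis
    show "\<And>a y. a \<in> Q' \<Longrightarrow> y \<in> X \<Longrightarrow> col a y = d'" using XQ' col_commute by metis
    show "\<And>a y. a \<in> Y \<Longrightarrow> y \<in> P \<Longrightarrow> col a y = d" using PY col_commute by metis
    show "\<And>a y. a \<in> Y \<Longrightarrow> y \<in> P' \<Longrightarrow> col a y = d'" using P'Y col_commute by metis
    show "\<not> three_parts B A col" using not_three by (simp add: three_parts_swap)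
  qed (use A B P Q kd card_X card_Y card_P card_P' card_Q card_Q' in auto)
qed


text \<open>\<open>R\<close> is what the full vertex \<open>q\<close> separates from the rest \<open>W\<close> of the component. \<open>R\<close> contains a \<open>c\<close>-full and a
  \<open>c'\<close>-full vertex of \<open>A\<close> but no full vertex of \<open>B\<close>. Then \<open>W\<close> without a set \<open>\<Lambda>\<close> of dispensable vertices
  serves as the tree of color \<open>k\<close>, and one tries to cover everything else by a tree of color \<open>c\<close> around \<open>q\<close>, and
  a tree of color \<open>c'\<close> containing \<open>V \<subseteq> Y\<close> and \<open>L \<subseteq> \<Lambda>\<close>. Each failing choice \<open>(V, L)\<close> yields a vertex of \<open>R\<close>
  whose edges to \<open>Y\<close> and \<open>\<Lambda>\<close> have color \<open>c\<close> exactly on \<open>V\<close> and \<open>L\<close>, so \<open>R\<close> is large.\<close>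

lemma separating_full_vertex_bound:
  assumes c: "{c, c'} = {d, d'}" and q: "q \<in> B1" "\<And>x. x \<in> X \<Longrightarrow> col x q = c"
    and WR: "A1 \<union> B1 = insert q (W \<union> R)" "q \<notin> W" "q \<notin> R" "W \<inter> R = {}"
    and W: "conn E W" and R: "conn E (insert q R)"
    and no_edge: "\<And>w r. w \<in> W \<Longrightarrow> r \<in> R \<Longrightarrow> \<not> E w r"
    and R_B: "\<And>b. b \<in> R \<inter> B1 \<Longrightarrow> (\<exists>x\<in>X. col x b = d) \<and> (\<exists>x\<in>X. col x b = d')"
    and pc: "pc \<in> R \<inter> A1" "\<And>y. y \<in> Y \<Longrightarrow> col pc y = c"
    and pc': "pc' \<in> R \<inter> A1" "\<And>y. y \<in> Y \<Longrightarrow> col pc' y = c'"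
  shows "card B0 + 3 \<le> card poor_A + card poor_B" "2 ^ (card Y - 1) \<le> card poor_A"
proof -
  have cc: "c \<noteq> c'" "k \<noteq> c" "k \<noteq> c'" using c kd by (auto simp: doubleton_eq_iff)
  have col_A1Y: "col a y = c \<or> col a y = c'" if "a \<in> A1" "y \<in> Y" for a y
    using col_A1Y[OF that] c by (auto simp: doubleton_eq_iff)
  have col_XB1: "col x b = c \<or> col x b = c'" if "x \<in> X" "b \<in> B1" for x b
    using col_XB1[OF that] c by (auto simp: doubleton_eq_iff)
  have R_Bc: "(\<exists>x\<in>X. col x b = c) \<and> (\<exists>x\<in>X. col x b = c')" if "b \<in> R \<inter> B1" for b
    using R_B[OF that] c by (auto simp: doubleton_eq_iff)
  have W_sub: "W \<subseteq> A1 \<union> B1" and R_sub: "R \<subseteq> A1 \<union> B1" using WR by auto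
  have finW: "finite W" using W_sub fin finite_subset by blast
  have qA: "q \<notin> A1" using q A1_B1 by blast
  have WR_A: "a \<in> W \<or> a \<in> R" if "a \<in> A1" for a
    using that qA equalityD1[OF WR(1)] by blast
  have WR_B: "b \<in> W \<or> b \<in> R" if "b \<in> B1" "b \<noteq> q" for b
    using that equalityD1[OF WR(1)] by blast
  have col_RW: "col a b = c \<or> col a b = c'" if "a \<in> R \<inter> A1" "b \<in> W \<inter> B1" for a b
  proof -
    have "col a b \<noteq> k" using no_edge[of b a] that adjI'[of a b k] X_A Y_B by blast
    moreover have "col a b \<in> {k, d, d'}" using col_AB that X_A Y_B by blast
    ultimately show ?thesis using c by (auto simp: doubleton_eq_iff)
  qed
  have core_B: "Q \<union> Q' - {q} \<subseteq> W"
  proof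
    fix b assume b: "b \<in> Q \<union> Q' - {q}"
    have "b \<notin> R"
    proof
      assume "b \<in> R"
      then have "(\<exists>x\<in>X. col x b = d) \<and> (\<exists>x\<in>X. col x b = d')" using R_B[of b] b Q by blast
      then obtain x x' where x: "x \<in> X" "col x b = d" "x' \<in> X" "col x' b = d'" by blast
      show False
      proof (cases "b \<in> Q")
        case True
        then show False using XQ[of x' b] x kd by simp
      next
        case False
        then show False using XQ'[of x b] b x kd by simp
      qed
    qed
    then show "b \<in> W" using WR_B[of b] b Q by blast
  qed
  have ne: "Q - {q} \<noteq> {}" "Q' - {q} \<noteq> {}"
  proof -
    have "card (Q - {q}) > 0" "card (Q' - {q}) > 0"
      using card_Q card_Q' by (auto simp: card_Diff_singleton_if)
    then show "Q - {q} \<noteq> {}" "Q' - {q} \<noteq> {}" unfolding card_gt_0_iff by blast+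
  qed
  \<comment> \<open>Each vertex of P and P' keeps a neighbour of color \<open>k\<close> in Q or Q'
    after the deletion of \<open>q\<close>, so it cannot be separated either.\<close>
  have core_A: "P \<union> P' \<subseteq> W"
  proof
    fix a assume a: "a \<in> P \<union> P'"
    then obtain b where b: "b \<in> Q \<union> Q' - {q}" "col a b = k" using ne PQ' P'Q by blast
    then have "E b a" using a P Q X_A Y_B by (intro adjI') auto
    then have "a \<notin> R" using no_edge[of b a] b(1) core_B by blast
    then show "a \<in> W" using WR_A[of a] a P by blast
  qed
  define RA where "RA = R \<inter> A1"
  have finRA: "finite RA" using fin by (simp add: RA_def)
  have RA_poor: "RA \<subseteq> poor_A"
  proof
    fix a assume a: "a \<in> RA"
    have "{b \<in> Q \<union> Q'. col a b = k} \<subseteq> {q}"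
    proof
      fix b assume b: "b \<in> {b \<in> Q \<union> Q'. col a b = k}"
      show "b \<in> {q}"
      proof (rule ccontr)
        assume "b \<notin> {q}"
        then have "b \<in> W \<inter> B1" using b core_B Q by blast
        then have "col a b \<noteq> k" using col_RW[of a b] a cc by (auto simp: RA_def)
        then show False using b by blast
      qed
    qed
    then have "card {b \<in> Q \<union> Q'. col a b = k} \<le> 1" using card_mono[of "{q}"] by simp
    moreover have "a \<in> A0" using a core_A WR(4) by (auto simp: RA_def A0_def)
    ultimately show "a \<in> poor_A" by (simp add: poor_A_def)
  qed
  have fin_poor: "finite poor_A" "finite poor_B" "finite B0"
    using fin by (auto simp: poor_A_def poor_B_def A0_def B0_def)
  \<comment> \<open>Candidates for dispensable vertices: an edge of color \<open>k\<close> to P or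
    P' makes them leaves on the core of W. With the threshold two, N and \<open>q\<close> exhaust
    the part of B0 that is not poor.\<close>
  define N where "N = {b \<in> W \<inter> B0. 2 \<le> card {a \<in> P \<union> P'. col a b = k}}"
  have finN: "finite N" using fin_poor by (simp add: N_def)
  have N_adj: "\<exists>a\<in>P \<union> P'. col a b = k" if "2 \<le> card {a \<in> P \<union> P'. col a b = k}" for b
  proof (rule ccontr)
    assume "\<not> ?thesis"
    then have "{a \<in> P \<union> P'. col a b = k} = {}" by blast
    then show False using that by (simp only: card.empty)
  qed
  have B0_N: "B0 - poor_B \<subseteq> insert q N"
  proof
    fix b assume b: "b \<in> B0 - poor_B"
    then have two: "2 \<le> card {a \<in> P \<union> P'. col a b = k}" by (auto simp: poor_B_def)
    have "b \<in> W" if "b \<noteq> q"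
    proof (rule ccontr)
      assume "b \<notin> W"
      then have "b \<in> R" using WR_B[of b] that b by (auto simp: B0_def)
      moreover obtain a where "a \<in> P \<union> P'" "col a b = k" using N_adj[OF two] by blast
      moreover have "E a b" using calculation b P X_A Y_B by (intro adjI) (auto simp: B0_def)
      ultimately show False using no_edge core_A by blast
    qed
    then show "b \<in> insert q N" using b two by (auto simp: N_def)
  qed
  \<comment> \<open>The two connected sets are complete bipartite graphs of color \<open>k\<close>.
    A vertex of A1 in W with no edge of color \<open>k\<close> into them is poor, so T consists of
    the poor vertices of W, and the price of connectivity is again counted in poor vertices.\<close>
  have "\<exists>N'\<subseteq>N. card N' \<le> card (poor_A - RA) + 1 \<and> (\<forall>L\<subseteq>N - N'. conn E (W - L))"
  proof (rule conn_few_connectors[OF adj_symp W finW])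
    show "N \<subseteq> W" by (auto simp: N_def)
    show "\<not> E u v" if "u \<in> N" "v \<in> N" for u v
      using that AB X_A Y_B by (auto simp: N_def B0_def adj_def)
    show "conn E (P \<union> (Q' - {q}))"
      by (rule conn_complete) (use P Q X_A Y_B ne card_P PQ' in auto)
    show "P \<union> (Q' - {q}) \<subseteq> W - N"
      using core_A core_B P Q A1_B1 by (auto simp: N_def B0_def)
    show "conn E (P' \<union> (Q - {q}))"
      by (rule conn_complete) (use P Q X_A Y_B ne card_P' P'Q in auto)
    show "P' \<union> (Q - {q}) \<subseteq> W - N"
      using core_A core_B P Q A1_B1 by (auto simp: N_def B0_def)
    show "\<exists>h\<in>P \<union> (Q' - {q}) \<union> (P' \<union> (Q - {q})). E h u" if u: "u \<in> N" for u
    proof -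
      obtain a where "a \<in> P \<union> P'" "col a u = k" using N_adj[of u] u by (auto simp: N_def)
      moreover have "E a u" using calculation u P X_A Y_B by (intro adjI) (auto simp: N_def B0_def)
      ultimately show ?thesis by blast
    qed
    show "v \<in> poor_A - RA \<or> v \<in> P \<union> (Q' - {q}) \<union> (P' \<union> (Q - {q}))
        \<or> (\<exists>h\<in>P \<union> (Q' - {q}) \<union> (P' \<union> (Q - {q})). E h v)"
      if u: "u \<in> N" and v: "v \<in> W - N" and "E u v" for u v
    proof (cases "v \<in> P \<union> P' \<or> (\<exists>b\<in>Q \<union> Q' - {q}. col v b = k)")
      case True
      have "u \<in> B" using u Y_B by (auto simp: N_def B0_def)
      then have "v \<in> A" using \<open>E u v\<close> AB by (auto simp: adj_def)
      then show ?thesis using True Q Y_B adjI'[of v _ k] by blast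
    next
      case False
      have "u \<in> B" using u Y_B by (auto simp: N_def B0_def)
      then have "v \<in> A" using \<open>E u v\<close> AB by (auto simp: adj_def)
      then have vA: "v \<in> A1" using v W_sub AB Y_B by blast
      have "{b \<in> Q \<union> Q'. col v b = k} \<subseteq> {q}" using False by blast
      then have "card {b \<in> Q \<union> Q'. col v b = k} \<le> 1" using card_mono[of "{q}"] by simp
      then have "v \<in> poor_A" using vA False by (simp add: poor_A_def A0_def)
      then show ?thesis using v WR(4) by (auto simp: RA_def)
    qed
    show "finite (poor_A - RA)" using fin_poor by simp
  qed
  then obtain N' where N': "N' \<subseteq> N" "card N' \<le> card (poor_A - RA) + 1"
    and conn_L: "\<And>L. L \<subseteq> N - N' \<Longrightarrow> conn E (W - L)" by blast
  define \<Lambda> where "\<Lambda> = N - N'"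
  have \<Lambda>_sub: "\<Lambda> \<subseteq> W \<inter> B1" by (auto simp: \<Lambda>_def N_def B0_def)
  have fin\<Lambda>: "finite \<Lambda>" using finN by (simp add: \<Lambda>_def)
  have \<Lambda>_mixed: "(\<exists>x\<in>X. col x b = c) \<and> (\<exists>x\<in>X. col x b = c')" if b: "b \<in> \<Lambda>" for b
  proof (rule ccontr)
    assume neg: "\<not> ?thesis"
    have bW: "b \<in> W" "b \<in> B1" using b \<Lambda>_sub by auto
    obtain cb where cb: "cb = c \<or> cb = c'" "\<And>x. x \<in> X \<Longrightarrow> col x b = cb"
      using neg col_XB1[OF _ bW(2)] by blast
    \<comment> \<open>A full \<open>b\<close> could be paired with a full vertex \<open>p\<close> of \<open>R\<close> behind which no further full vertex lies.\<close>
    define G where "G p = component E (insert q R - {p}) q" for p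
    define full where "full p \<longleftrightarrow> p \<in> RA \<and> ((\<forall>y\<in>Y. col p y = c) \<or> (\<forall>y\<in>Y. col p y = c'))" for p
    have "full pc" using pc by (simp add: full_def RA_def)
    moreover have "\<forall>p. full p \<longrightarrow> card (G p) < Suc (card (insert q R))"
    proof (intro allI impI)
      fix p
      have "finite (insert q R)" using R_sub fin finite_subset by blast
      moreover have "G p \<subseteq> insert q R"
        using component_subset[of E "insert q R - {p}" q] by (auto simp: G_def)
      ultimately show "card (G p) < Suc (card (insert q R))" by (simp add: less_Suc_eq_le card_mono)
    qed
    ultimately obtain p where p: "full p" and max: "\<And>p'. full p' \<Longrightarrow> card (G p') \<le> card (G p)"
      using ex_has_greatest_nat[of full pc "\<lambda>p. card (G p)" "Suc (card (insert q R))"] by blast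
    have pR: "p \<in> R" "p \<in> A1" "p \<noteq> q" using p WR(3) by (auto simp: full_def RA_def)
    have Gp: "q \<in> G p" "conn E (G p)" "G p \<subseteq> insert q R - {p}"
      using pR component_refl[of q "insert q R - {p}" E] component_conn[of q "insert q R - {p}" E]
        component_subset[of E "insert q R - {p}" q] by (auto simp: G_def)
    \<comment> \<open>Otherwise deleting \<open>a\<close> instead of \<open>p\<close> would leave
      \<open>q\<close> connected to \<open>G p\<close> and to \<open>p\<close> itself, against
      maximality.\<close>
    have not_full: "\<not> full a" if a: "a \<in> RA" "a \<notin> G p" "a \<noteq> p" for a
    proof
      assume "full a"
      have aq: "a \<noteq> q" using a(1) WR(3) by (auto simp: RA_def)
      have sub: "G p \<subseteq> G a"
        unfolding G_def[of a] using Gp a(2) by (intro component_max) auto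
      obtain w where w: "w \<in> G p" "E p w"
        using conn_neighbour_component[OF adj_symp R, of p q] pR unfolding G_def by blast
      have "p \<in> G a"
        unfolding G_def
      proof (rule component_closed[OF adj_symp])
        show "w \<in> component E (insert q R - {a}) q" using w sub by (auto simp: G_def)
        show "E w p" using w(2) adj_symp[of k] by (blast dest: sympD)
      qed (use pR a aq in auto)
      then have "insert p (G p) \<subseteq> G a" using sub by blast
      moreover have "finite (G a)"
        using component_subset[of E "insert q R - {a}" q] R_sub fin
        by (metis G_def finite_Diff finite_Un finite_insert finite_subset)
      ultimately have "card (insert p (G p)) \<le> card (G a)" by (intro card_mono)
      moreover have "finite (G p)" "p \<notin> G p"
        using \<open>finite (G a)\<close> sub Gp(3) by (auto dest: finite_subset)
      ultimately show False using max[OF \<open>full a\<close>] by simp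
    qed
    obtain w where w: "w \<in> W" "E w q"
    proof -
      have "W \<noteq> {}" using W by (simp add: conn_def)
      then obtain w v where "w \<in> W" "v \<in> A1 \<union> B1 - W" "E w v"
        using connD[OF conn1, of W] W_sub WR(2) q(1) by blast
      moreover have "v = q" using calculation no_edge[of w v] equalityD1[OF WR(1)] by blast
      ultimately show ?thesis using that by blast
    qed
    have "w \<noteq> b" using w(2) q(1) bW(2) AB Y_B by (auto simp: adj_def)
    have conn_b: "conn E (W - {b})" using conn_L[of "{b}"] b by (simp add: \<Lambda>_def)
    have conn_K: "conn E (W - {b} \<union> G p)"
      using conn_join[OF adj_symp conn_b Gp(2), of w q] w Gp(1) \<open>w \<noteq> b\<close> by simp
    obtain cp where cp: "cp = c \<or> cp = c'" "\<And>y. y \<in> Y \<Longrightarrow> col p y = cp"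
      using p by (auto simp: full_def)
    show False
    proof (rule full_pair_False[of p cp b cb "W - {b} \<union> G p"])
      show "W - {b} \<union> G p \<subseteq> A1 \<union> B1 - {p, b}"
        using W_sub R_sub Gp(3) q(1) pR bW WR by auto
      show "\<exists>y\<in>Y. col a y = cp" if a: "a \<in> A1 - (W - {b} \<union> G p) - {p}" for a
      proof -
        have "a \<notin> W" using a bW A1_B1 by blast
        then have "a \<in> RA" using WR_A[of a] a by (auto simp: RA_def)
        then have "\<not> full a" using not_full[of a] a by blast
        then show ?thesis using \<open>a \<in> RA\<close> cp(1) col_A1Y[of a] a by (auto simp: full_def)
      qed
      show "\<exists>x\<in>X. col x b' = cb" if b': "b' \<in> B1 - (W - {b} \<union> G p) - {b}" for b'
      proof -
        have "b' \<in> R \<inter> B1" using WR_B[of b'] b' Gp(1) by blast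
        then show ?thesis using R_Bc cb(1) by blast
      qed
    qed (use pR cp cb bW conn_K in auto)
  qed
  \<comment> \<open>\<open>y1\<close> stays out of every V below: the path from X over
    \<open>y1\<close> to \<open>pc\<close> joins the star of \<open>q\<close> to that of
    \<open>pc\<close> in color \<open>c\<close>.\<close>
  obtain x1 y1 where xy: "x1 \<in> X" "y1 \<in> Y" "col x1 y1 = c"
    using edge_d edge_d' c by (auto simp: doubleton_eq_iff)
  define sig where "sig a = ({y \<in> Y. col a y = c}, {b \<in> \<Lambda>. col a b = c})" for a
  have sig: "(V, L) \<in> sig ` RA"
    if V: "V \<subseteq> Y - {y1}" and L: "L \<subseteq> \<Lambda>" "L = {} \<or> V = {} \<and> (\<exists>b. L = {b})" for V L
  proof (rule ccontr)
    assume no_sig: "(V, L) \<notin> sig ` RA"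
    have no_sig: "\<not> ({y \<in> Y. col a y = c} = V \<and> {b \<in> \<Lambda>. col a b = c} = L)" if "a \<in> RA" for a
      using no_sig that by (auto simp: sig_def)
    \<comment> \<open>If V is nonempty, \<open>pc'\<close> must remain available as the center of
      the tree of color \<open>c'\<close>; if V is empty, the vertex of L, if any, is that
      center.\<close>
    define Excl where "Excl = (if V = {} then {} else {pc'})"
    define Bc where "Bc = (Y - V) \<union> (\<Lambda> - L) \<union> (R \<inter> B1) \<union> {q}"
    define Ac where "Ac = {a \<in> RA - Excl. \<exists>b\<in>Bc. col a b = c}"
    have "pc \<noteq> pc'" using pc pc' XY_ne cc by fastforce
    have y1: "y1 \<in> Y - V" using xy V by blast
    have pcAc: "pc \<in> Ac"
      using pc y1 \<open>pc \<noteq> pc'\<close> by (auto simp: Ac_def RA_def Bc_def Excl_def)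
    have Bc_B: "Bc \<subseteq> B" using Y_B \<Lambda>_sub q(1) by (auto simp: Bc_def)
    have "conn (adj A B col c) ({q} \<union> X)"
      by (rule conn_attach_A[OF conn_singleton]) (use q X_A Y_B in blast)+
    then have "conn (adj A B col c) ({q} \<union> X \<union> {y1})"
      by (rule conn_attach_B) (use xy X_A Y_B in blast)+
    then have "conn (adj A B col c) ({q} \<union> X \<union> {y1} \<union> {pc})"
      by (rule conn_attach_A) (use xy pc X_A Y_B in blast)+
    then have "conn (adj A B col c) ({q} \<union> X \<union> {y1} \<union> {pc} \<union> (Y - V))"
      by (rule conn_attach_B) (use pc X_A Y_B in blast)+
    then have "conn (adj A B col c) ({q} \<union> X \<union> {y1} \<union> {pc} \<union> (Y - V) \<union> ((\<Lambda> - L) \<union> (R \<inter> B1)))"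
    proof (rule conn_attach_B)
      show "\<Lambda> - L \<union> R \<inter> B1 \<subseteq> B" using \<Lambda>_sub Y_B by blast
      fix b assume "b \<in> \<Lambda> - L \<union> R \<inter> B1"
      then obtain x where "x \<in> X" "col x b = c" using \<Lambda>_mixed R_Bc by blast
      then show "\<exists>s\<in>({q} \<union> X \<union> {y1} \<union> {pc} \<union> (Y - V)) \<inter> A. col s b = c" using X_A by blast
    qed
    then have "conn (adj A B col c) ({q} \<union> X \<union> {y1} \<union> {pc} \<union> (Y - V) \<union> ((\<Lambda> - L) \<union> (R \<inter> B1)) \<union> Ac)"
    proof (rule conn_attach_A)
      show "Ac \<subseteq> A" using X_A by (auto simp: Ac_def RA_def)
      fix a assume "a \<in> Ac"
      then obtain b where "b \<in> Bc" "col a b = c" by (auto simp: Ac_def)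
      then show "\<exists>s\<in>({q} \<union> X \<union> {y1} \<union> {pc} \<union> (Y - V) \<union> ((\<Lambda> - L) \<union> (R \<inter> B1))) \<inter> B. col a s = c"
        using Bc_B by (auto simp: Bc_def)
    qed
    moreover have "{q} \<union> X \<union> {y1} \<union> {pc} \<union> (Y - V) \<union> ((\<Lambda> - L) \<union> (R \<inter> B1)) \<union> Ac = X \<union> Bc \<union> Ac"
      using pcAc y1 by (auto simp: Bc_def)
    ultimately have mono_c: "monochromatic A B col (X \<union> Bc \<union> Ac)"
      using monochromaticI by metis
    have left: "col a b \<noteq> c" if "a \<in> RA - Ac - Excl" "b \<in> Bc" for a b
      using that by (auto simp: Ac_def)
    have sig_left: "{y \<in> Y. col a y = c} \<subseteq> V" "{b \<in> \<Lambda>. col a b = c} \<subseteq> L" if "a \<in> RA - Ac - Excl" for a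
      using left[OF that] by (auto simp: Bc_def)
    have mono_c': "monochromatic A B col (V \<union> L \<union> (RA - Ac))"
    proof (cases "V = {}")
      case False
      then have L0: "L = {}" using L by blast
      have pc'_in: "pc' \<in> RA - Ac" using pc' False by (auto simp: Ac_def RA_def Excl_def)
      have "conn (adj A B col c') ({pc'} \<union> V)"
        by (rule conn_attach_B[OF conn_singleton]) (use pc' V X_A Y_B in blast)+
      then have "conn (adj A B col c') ({pc'} \<union> V \<union> (RA - Ac))"
      proof (rule conn_attach_A)
        show "RA - Ac \<subseteq> A" using X_A by (auto simp: RA_def)
        fix a assume a: "a \<in> RA - Ac" "a \<notin> {pc'} \<union> V"
        then have a': "a \<in> RA - Ac - Excl" using False by (simp add: Excl_def)
        \<comment> \<open>As \<open>a\<close> was not absorbed, its edges of color \<open>c\<close>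
          to Y end in V and it has none to \<open>\<Lambda>\<close>. Its signature is not (V, {}),
          so some edge to V has color \<open>c'\<close>.\<close>
        then have "{y \<in> Y. col a y = c} \<noteq> V"
          using no_sig[of a] sig_left[of a] L0 by blast
        then obtain y where "y \<in> V" "col a y \<noteq> c" using sig_left(1)[OF a'] V by blast
        then have "col a y = c'" using col_A1Y[of a y] a V by (auto simp: RA_def)
        then show "\<exists>s\<in>({pc'} \<union> V) \<inter> B. col a s = c'" using \<open>y \<in> V\<close> V Y_B by blast
      qed
      moreover have "{pc'} \<union> V \<union> (RA - Ac) = V \<union> L \<union> (RA - Ac)" using pc'_in L0 by blast
      ultimately show ?thesis using monochromaticI by metis
    next
      case True
      then have left_c: "{b \<in> \<Lambda>. col a b = c} \<noteq> L" if "a \<in> RA - Ac" for a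
        using no_sig[of a] sig_left(1)[of a] that by (auto simp: Excl_def)
      have left_sub: "{b \<in> \<Lambda>. col a b = c} \<subseteq> L" if "a \<in> RA - Ac" for a
        using sig_left(2)[of a] that True by (simp add: Excl_def)
      show ?thesis
      proof (cases "L = {}")
        case L0: True
        have "RA - Ac = {}" using left_c left_sub L0 by blast
        then show ?thesis using True L0 by (simp add: monochromatic_def)
      next
        case False
        then obtain b where b: "L = {b}" using L by blast
        have "conn (adj A B col c') ({b} \<union> (RA - Ac))"
        proof (rule conn_attach_A[OF conn_singleton])
          show "RA - Ac \<subseteq> A" using X_A by (auto simp: RA_def)
          fix a assume a: "a \<in> RA - Ac"
          have "col a b \<noteq> c"
          proof
            assume "col a b = c"
            then have "L \<subseteq> {b \<in> \<Lambda>. col a b = c}" using b L by blast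
            then show False using left_c[OF a] left_sub[OF a] by blast
          qed
          then have "col a b = c'" using col_RW[of a b] a b L \<Lambda>_sub by (auto simp: RA_def)
          then show "\<exists>s\<in>{b} \<inter> B. col a s = c'" using b L \<Lambda>_sub Y_B by blast
        qed
        then show ?thesis using True b monochromaticI by simp
      qed
    qed
    have "three_parts A B col"
    proof (rule three_partsI[OF _ _ _ _ monochromaticI[OF conn_L] mono_c mono_c'])
      have R_split: "R = RA \<union> R \<inter> B1" using R_sub by (auto simp: RA_def)
      have Ac_RA: "Ac \<subseteq> RA" by (auto simp: Ac_def)
      have "A \<union> B = W \<union> R \<union> {q} \<union> X \<union> Y" using A(1) B(1) WR(1) by auto
      also have "\<dots> = (W - \<Lambda>) \<union> \<Lambda> \<union> (RA \<union> R \<inter> B1) \<union> {q} \<union> X \<union> Y"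
        using \<Lambda>_sub R_split by auto
      also have "\<dots> = W - \<Lambda> \<union> (X \<union> Bc \<union> Ac) \<union> (V \<union> L \<union> (RA - Ac))"
        using V L(1) Ac_RA by (auto simp: Bc_def)
      finally show "A \<union> B = W - \<Lambda> \<union> (X \<union> Bc \<union> Ac) \<union> (V \<union> L \<union> (RA - Ac))" .
      show "\<Lambda> \<subseteq> N - N'" by (simp add: \<Lambda>_def)
      have WX: "W \<inter> (X \<union> Y) = {}" using W_sub A B AB by auto
      have RX: "R \<inter> (X \<union> Y) = {}" using R_sub A B AB by auto
      have qX: "q \<notin> X \<union> Y" using q(1) A B AB by auto
      show "(W - \<Lambda>) \<inter> (X \<union> Bc \<union> Ac) = {}"
        using WX WR Ac_RA by (auto simp: Bc_def RA_def)
      show "(W - \<Lambda>) \<inter> (V \<union> L \<union> (RA - Ac)) = {}"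
        using WX WR V L(1) by (auto simp: RA_def)
      have "X \<inter> Y = {}" using A B AB by auto
      then have X: "v \<notin> Y \<and> v \<notin> W \<and> v \<notin> R" if "v \<in> X" for v
        using WX RX that by blast
      have Y: "v \<notin> W \<and> v \<notin> R" if "v \<in> Y" for v using WX RX that by blast
      have "v \<notin> V \<union> L \<union> (RA - Ac)" if "v \<in> X \<union> Bc \<union> Ac" for v
        using that
      proof (elim UnE)
        assume "v \<in> X"
        then show ?thesis using X V L(1) \<Lambda>_sub by (auto simp: RA_def)
      next
        assume "v \<in> Bc"
        then consider "v \<in> Y - V" | "v \<in> \<Lambda> - L" | "v \<in> R \<inter> B1" | "v = q" by (auto simp: Bc_def)
        then show ?thesis
        proof cases
          case 1
          then show ?thesis using Y L(1) \<Lambda>_sub by (auto simp: RA_def)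
        next
          case 2
          then show ?thesis using Y V \<Lambda>_sub WR(4) by (auto simp: RA_def)
        next
          case 3
          then show ?thesis using Y V L(1) \<Lambda>_sub WR(4) A1_B1 by (auto simp: RA_def)
        next
          case 4
          then show ?thesis using qX V L(1) \<Lambda>_sub WR(2,3) by (auto simp: RA_def)
        qed
      next
        assume "v \<in> Ac"
        then show ?thesis using Y V L(1) \<Lambda>_sub WR(4) by (auto simp: Ac_def RA_def)
      qed
      then show "(X \<union> Bc \<union> Ac) \<inter> (V \<union> L \<union> (RA - Ac)) = {}" by blast
    qed
    then show False using not_three by simp
  qed
  \<comment> \<open>All signatures (V, {}) and ({}, {b}) are realised, and \<open>pc\<close> adds
    one more, since it sends color \<open>c\<close> to all of Y including \<open>y1\<close>.\<close>
  have "Pow (Y - {y1}) \<times> {{}} \<union> {{}} \<times> ((\<lambda>b. {b}) ` \<Lambda>) \<union> {sig pc} \<subseteq> sig ` RA"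
    using sig pc(1) by (auto simp: RA_def)
  moreover have "card (Pow (Y - {y1}) \<times> {{}} \<union> {{}} \<times> ((\<lambda>b. {b}) ` \<Lambda>) \<union> {sig pc}) = 2 ^ (card Y - 1) + card \<Lambda> + 1"
  proof -
    have "card (Pow (Y - {y1}) \<times> {{} :: 'v set}) = 2 ^ (card Y - 1)"
      using fin xy by (simp add: card_cartesian_product card_Pow card_Diff_singleton_if)
    moreover have "card ({{} :: 'v set} \<times> ((\<lambda>b. {b}) ` \<Lambda>)) = card \<Lambda>"
      by (simp add: card_cartesian_product card_image)
    moreover have "card (Pow (Y - {y1}) \<times> {{}} \<union> {{}} \<times> ((\<lambda>b. {b}) ` \<Lambda>))
        = card (Pow (Y - {y1}) \<times> {{} :: 'v set}) + card ({{} :: 'v set} \<times> ((\<lambda>b. {b}) ` \<Lambda>))"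
      using fin fin\<Lambda> by (intro card_Un_disjoint) auto
    moreover have "fst (sig pc) = Y" using pc by (auto simp: sig_def)
    then have "sig pc \<notin> Pow (Y - {y1}) \<times> {{}} \<union> {{}} \<times> ((\<lambda>b. {b}) ` \<Lambda>)"
      using xy by (cases "sig pc") auto
    ultimately show ?thesis using fin fin\<Lambda> by simp
  qed
  ultimately have "2 ^ (card Y - 1) + card \<Lambda> + 1 \<le> card (sig ` RA)"
    using card_mono finRA by (metis finite_imageI)
  then have card_RA: "2 ^ (card Y - 1) + card \<Lambda> + 1 \<le> card RA"
    using card_image_le[OF finRA, of sig] by linarith
  have RA_le: "card RA \<le> card poor_A" using RA_poor fin_poor by (auto intro: card_mono)
  then have poor_split: "card poor_A = card RA + card (poor_A - RA)"
    using RA_poor by (simp add: card_Diff_subset finRA)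
  show "2 ^ (card Y - 1) \<le> card poor_A" using card_RA RA_le by linarith
  \<comment> \<open>Origin of the 3 in the bound: the subsets V give at least 4 signatures and
    \<open>pc\<close> one more, while \<open>q\<close> and the extra connector of the budget cost
    one each.\<close>
  have "(2 :: nat) ^ 2 \<le> 2 ^ (card Y - 1)" using card_Y by (intro power_increasing) auto
  then have four: "4 \<le> (2 :: nat) ^ (card Y - 1)" by simp
  have "card (B0 - poor_B) \<le> card (insert q N)"
    using B0_N finN by (intro card_mono) auto
  also have "\<dots> \<le> card N + 1" using finN by (simp add: card_insert_if)
  also have "card N = card N' + card \<Lambda>"
    using N'(1) finN by (simp add: \<Lambda>_def card_Diff_subset finite_subset card_mono)
  finally have "card (B0 - poor_B) \<le> card N' + card \<Lambda> + 1" .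
  moreover have "card (B0 - poor_B) = card B0 - card poor_B"
    using fin_poor by (intro card_Diff_subset) (auto simp: poor_B_def)
  ultimately show "card B0 + 3 \<le> card poor_A + card poor_B"
    using N'(2) card_RA four poor_split by linarith
qed


text \<open>Suppose R has a full vertex \<open>a\<close> of A. If no vertex of A in R were full in
  the other color, the pair \<open>a\<close>, \<open>q\<close> with the tree W would already give
  three parts, since every leftover vertex could join a star. So both kinds of full vertices occur
  in R, as \<open>separating_full_vertex_bound\<close> requires.\<close>

lemma bound_or_no_full_vertex:
  assumes q: "q \<in> B1" "(\<forall>x\<in>X. col x q = d) \<or> (\<forall>x\<in>X. col x q = d')" and p: "p \<in> A1"
    and R: "R = A1 \<union> B1 - {q} - component E (A1 \<union> B1 - {q}) p"
    and R_B: "\<And>b. b \<in> R \<inter> B1 \<Longrightarrow> (\<exists>x\<in>X. col x b = d) \<and> (\<exists>x\<in>X. col x b = d')"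
  shows "(card B0 + 3 \<le> card poor_A + card poor_B \<and> 2 ^ (card Y - 1) \<le> card poor_A) \<or>
    (\<forall>a\<in>R \<inter> A1. (\<exists>y\<in>Y. col a y = d) \<and> (\<exists>y\<in>Y. col a y = d'))"
proof (rule disjCI)
  assume "\<not> (\<forall>a\<in>R \<inter> A1. (\<exists>y\<in>Y. col a y = d) \<and> (\<exists>y\<in>Y. col a y = d'))"
  then obtain a ca where a: "a \<in> R \<inter> A1" "ca = d \<or> ca = d'" "\<And>y. y \<in> Y \<Longrightarrow> col a y = ca"
    using col_A1Y by (metis IntD2)
  define W where "W = component E (A1 \<union> B1 - {q}) p"
  have pq: "p \<in> A1 \<union> B1 - {q}" using p q A1_B1 by blast
  have W: "conn E W" "W \<subseteq> A1 \<union> B1 - {q}"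
    unfolding W_def by (rule component_conn[OF pq], rule component_subset)
  have R': "R = A1 \<union> B1 - {q} - W" by (simp add: R W_def)
  have all: "A1 \<union> B1 = insert q (W \<union> R)" using W R' q by auto
  have "A1 \<union> B1 - W = insert q R" using W R' q by auto
  moreover have "conn E (A1 \<union> B1 - W)"
    unfolding W_def by (rule conn_minus_component[OF adj_symp conn1 _ pq]) (use q in simp)
  ultimately have conn_R: "conn E (insert q R)" by simp
  have no_edge: "\<not> E w r" if "w \<in> W" "r \<in> R" for w r
    using component_closed[OF adj_symp pq, of w k r] that R' by (auto simp: W_def)
  obtain cq where cq: "cq = d \<or> cq = d'" "\<And>x. x \<in> X \<Longrightarrow> col x q = cq" using q(2) by blast
  define ca' where "ca' = (if ca = d then d' else d)"
  have "\<exists>a'\<in>R \<inter> A1. \<forall>y\<in>Y. col a' y = ca'"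
  proof (rule ccontr)
    assume no: "\<not> ?thesis"
    show False
    proof (rule full_pair_False[of a ca q cq W])
      show "W \<subseteq> A1 \<union> B1 - {a, q}" using W a R' by auto
      show "\<exists>y\<in>Y. col a' y = ca" if "a' \<in> A1 - W - {a}" for a'
      proof -
        have "a' \<in> R \<inter> A1" using that R' q A1_B1 by blast
        then obtain y where "y \<in> Y" "col a' y \<noteq> ca'" using no by blast
        then show ?thesis using col_A1Y[of a' y] that a(2) by (auto simp: ca'_def split: if_splits)
      qed
      show "\<exists>x\<in>X. col x b = cq" if "b \<in> B1 - W - {q}" for b
        using R_B[of b] that R' cq(1) by blast
    qed (use a q cq W in auto)
  qed
  then obtain a' where a': "a' \<in> R \<inter> A1" "\<And>y. y \<in> Y \<Longrightarrow> col a' y = ca'" by blast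
  have "\<exists>pd pd'. pd \<in> R \<inter> A1 \<and> pd' \<in> R \<inter> A1 \<and> (\<forall>y\<in>Y. col pd y = d) \<and> (\<forall>y\<in>Y. col pd' y = d')"
    using a a' by (cases "ca = d") (auto simp: ca'_def)
  then obtain pd pd' where pd: "pd \<in> R \<inter> A1" "\<And>y. y \<in> Y \<Longrightarrow> col pd y = d"
    and pd': "pd' \<in> R \<inter> A1" "\<And>y. y \<in> Y \<Longrightarrow> col pd' y = d'" by blast
  have sets: "q \<notin> W" "q \<notin> R" "W \<inter> R = {}" using W R' by auto
  show "card B0 + 3 \<le> card poor_A + card poor_B \<and> 2 ^ (card Y - 1) \<le> card poor_A"
  proof (cases "cq = d")
    case True
    note st = separating_full_vertex_bound[of d d' q W R pd pd', OF refl q(1) cq(2)[unfolded True] all sets W(1) conn_R no_edge R_B pd pd']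
    show ?thesis using st by blast
  next
    case False
    then have "cq = d'" using cq(1) by simp
    note st = separating_full_vertex_bound[of d' d q W R pd' pd, OF insert_commute q(1) cq(2)[unfolded this] all sets W(1) conn_R no_edge R_B pd' pd]
    show ?thesis using st by blast
  qed
qed

lemma neighbour_component_extend:
  assumes "conn E W" "conn E K" "K \<subseteq> W" "p \<in> K" "a \<in> W" "a \<notin> K"
  shows "\<exists>K'. K \<subseteq> K' \<and> K' \<subseteq> W - {a} \<and> conn E K' \<and> (\<exists>w\<in>K'. E a w)"
proof (intro exI conjI)
  show "K \<subseteq> component E (W - {a}) p" using assms by (intro component_max) auto
  show "component E (W - {a}) p \<subseteq> W - {a}" by (rule component_subset)
  show "conn E (component E (W - {a}) p)" using assms by (intro component_conn) auto
  show "\<exists>w\<in>component E (W - {a}) p. E a w"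
    using assms by (intro conn_neighbour_component[OF adj_symp]) auto
qed

text \<open>If both alternatives fail, \<open>bound_or_no_full_vertex\<close>, used for
  \<open>q\<close> and with exchanged sides for \<open>p\<close>, excludes full vertices of A behind
  \<open>q\<close> and of B behind \<open>p\<close>. The full vertices not behind them are excluded
  by a maximal choice of K, and \<open>full_pair_False\<close> applies.\<close>

lemma poor_dichotomy:
  "card B0 + 3 \<le> card poor_A + card poor_B \<and> 2 ^ (card Y - 1) \<le> card poor_A \<or>
   card A0 + 3 \<le> card poor_A + card poor_B \<and> 2 ^ (card X - 1) \<le> card poor_B"
proof (rule ccontr)
  assume neg: "\<not> ?thesis"
  interpret sw: main_color B A col k d d' B1 Y A1 X Q Q' P P' by (rule swap_main)
  have sw_eq: "sw.A0 = B0" "sw.B0 = A0" "sw.poor_A = poor_B" "sw.poor_B = poor_A"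
    by (simp_all add: sw.A0_def sw.B0_def A0_def B0_def sw.poor_A_def sw.poor_B_def poor_A_def poor_B_def
        col_commute)
  define full_A where "full_A a \<longleftrightarrow> a \<in> A1 \<and> ((\<forall>y\<in>Y. col a y = d) \<or> (\<forall>y\<in>Y. col a y = d'))" for a
  define full_B where "full_B b \<longleftrightarrow> b \<in> B1 \<and> ((\<forall>x\<in>X. col x b = d) \<or> (\<forall>x\<in>X. col x b = d'))" for b
  have not_full_A: "(\<exists>y\<in>Y. col a y = d) \<and> (\<exists>y\<in>Y. col a y = d')" if "a \<in> A1" "\<not> full_A a" for a
    using that col_A1Y by (auto simp: full_A_def)
  have not_full_B: "(\<exists>x\<in>X. col x b = d) \<and> (\<exists>x\<in>X. col x b = d')" if "b \<in> B1" "\<not> full_B b" for b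
    using that col_XB1 by (auto simp: full_B_def)
  \<comment> \<open>Among full pairs \<open>p\<close>, \<open>q\<close> both adjacent to a connected set \<open>K\<close> avoiding them, take one with \<open>K\<close> maximal:
    a full vertex outside \<open>K\<close> is then separated from \<open>K\<close> by \<open>p\<close> or by \<open>q\<close>, or else it could replace one of them.\<close>
  define V where "V = A1 \<union> B1"
  have finV: "finite V" using fin by (simp add: V_def)
  define nice where "nice = (\<lambda>(p, q, K). full_A p \<and> full_B q \<and> K \<subseteq> V - {p, q} \<and> conn E K \<and>
      (\<exists>w\<in>K. E p w) \<and> (\<exists>w\<in>K. E q w))"
  \<comment> \<open>The start uses P and Q', whose mutual edges all have color \<open>k\<close>;
    both have a further vertex to form K.\<close>
  obtain p0 q0 where p0: "p0 \<in> P" and q0: "q0 \<in> Q'" using card_P card_Q' by fastforce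
  have ne: "P - {p0} \<noteq> {}" "Q' - {q0} \<noteq> {}"
  proof -
    have "card (P - {p0}) > 0" "card (Q' - {q0}) > 0"
      using card_P card_Q' by (auto simp: card_Diff_singleton_if)
    then show "P - {p0} \<noteq> {}" "Q' - {q0} \<noteq> {}" unfolding card_gt_0_iff by blast+
  qed
  have "nice (p0, q0, (P - {p0}) \<union> (Q' - {q0}))"
  proof -
    have "conn E ((P - {p0}) \<union> (Q' - {q0}))"
      by (rule conn_complete) (use P Q X_A Y_B ne PQ' in auto)
    moreover have "E a b" "E b a" if "a \<in> P" "b \<in> Q'" for a b
    proof -
      have "a \<in> A" "b \<in> B" using that P(1) Q(2) X_A(2) Y_B(2) by blast+
      then show "E a b" "E b a" using PQ'[OF that] by (simp_all add: adjI adjI')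
    qed
    then have "\<exists>w\<in>Q' - {q0}. E p0 w" "\<exists>w\<in>P - {p0}. E q0 w" using ne p0 q0 by blast+
    moreover have "full_A p0" "full_B q0" using p0 q0 P Q PY XQ' by (auto simp: full_A_def full_B_def)
    moreover have "(P - {p0}) \<union> (Q' - {q0}) \<subseteq> V - {p0, q0}"
      using p0 q0 P Q A1_B1 by (auto simp: V_def)
    ultimately show ?thesis by (auto simp: nice_def)
  qed
  moreover have "\<forall>t. nice t \<longrightarrow> card (snd (snd t)) < Suc (card V)"
    using finV by (auto simp: nice_def less_Suc_eq_le intro!: card_mono)
  ultimately obtain t where "nice t" and max: "\<And>t'. nice t' \<Longrightarrow> card (snd (snd t')) \<le> card (snd (snd t))"
    using ex_has_greatest_nat[of nice _ "\<lambda>t. card (snd (snd t))" "Suc (card V)"] by blast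
  then obtain p q K where t: "t = (p, q, K)" "nice (p, q, K)" by (metis prod_cases3)
  have p: "full_A p" "p \<in> A1" and q: "full_B q" "q \<in> B1" and K: "K \<subseteq> V - {p, q}" "conn E K"
    and pK: "\<exists>w\<in>K. E p w" and qK: "\<exists>w\<in>K. E q w"
    using t(2) by (auto simp: nice_def full_A_def full_B_def)
  have max: False if "nice (p', q', K')" "K \<subset> K'" for p' q' K'
  proof -
    have "finite K'" using that(1) finV by (auto simp: nice_def dest: finite_subset)
    then have "card K < card K'" using that(2) by (rule psubset_card_mono)
    then show False using max[OF that(1)] t(1) by simp
  qed
  have pq: "p \<noteq> q" using p q A1_B1 by blast
  have pV: "p \<in> V - {q}" "q \<in> V - {p}" using p q pq by (auto simp: V_def)
  have Kp: "conn E (K \<union> {p})" and Kq: "conn E (K \<union> {q})"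
    using pK qK adj_symp[of k] by (intro conn_attach[OF adj_symp K(2)]; blast dest: sympD)+
  define Wq where "Wq = component E (V - {q}) p"
  define Wp where "Wp = component E (V - {p}) q"
  have Wq: "conn E Wq" "Wq \<subseteq> V - {q}" "K \<union> {p} \<subseteq> Wq"
    unfolding Wq_def using component_conn[OF pV(1)] component_subset[of E "V - {q}" p]
      component_max[OF Kp, of "V - {q}" p] K(1) pV by auto
  have Wp: "conn E Wp" "Wp \<subseteq> V - {p}" "K \<union> {q} \<subseteq> Wp"
    unfolding Wp_def using component_conn[OF pV(2)] component_subset[of E "V - {p}" q]
      component_max[OF Kq, of "V - {p}" q] K(1) pV by auto
  have full_A_Wq: "a \<in> K \<union> {p}" if a: "full_A a" "a \<in> Wq" for a
  proof (rule ccontr)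
    assume "a \<notin> K \<union> {p}"
    then obtain K' where K': "K \<union> {p} \<subseteq> K'" "K' \<subseteq> Wq - {a}" "conn E K'" "\<exists>w\<in>K'. E a w"
      using neighbour_component_extend[OF Wq(1) Kp Wq(3), of p a] a(2) by blast
    have "nice (a, q, K')"
      using a(1) q K' Wq(2) qK by (auto simp: nice_def)
    moreover have "K \<subset> K'" using K'(1) K(1) by blast
    ultimately show False by (rule max)
  qed
  have full_B_Wp: "b \<in> K \<union> {q}" if b: "full_B b" "b \<in> Wp" for b
  proof (rule ccontr)
    assume "b \<notin> K \<union> {q}"
    then obtain K' where K': "K \<union> {q} \<subseteq> K'" "K' \<subseteq> Wp - {b}" "conn E K'" "\<exists>w\<in>K'. E b w"
      using neighbour_component_extend[OF Wp(1) Kq Wp(3), of q b] b(2) by blast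
    have "nice (p, b, K')"
      using b(1) p K' Wp(2) pK by (auto simp: nice_def)
    moreover have "K \<subset> K'" using K'(1) K(1) by blast
    ultimately show False by (rule max)
  qed
  have connV: "conn E V" using conn1 by (simp add: V_def)
  \<comment> \<open>What \<open>q\<close> cuts off stays attached to \<open>q\<close> when
    \<open>p\<close> is deleted. So full vertices of B behind \<open>q\<close> fall under
    \<open>full_B_Wp\<close>, which provides the hypothesis on R of the bound.\<close>
  have Rq_Wp: "V - Wq \<subseteq> Wp"
    unfolding Wp_def
  proof (rule component_max)
    show "conn E (V - Wq)"
      unfolding Wq_def by (rule conn_minus_component[OF adj_symp connV _ pV(1)]) (use pV in simp)
  qed (use Wq pV in auto)
  have Rp_Wq: "V - Wp \<subseteq> Wq"
    unfolding Wq_def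
  proof (rule component_max)
    show "conn E (V - Wp)"
      unfolding Wp_def by (rule conn_minus_component[OF adj_symp connV _ pV(2)]) (use pV in simp)
  qed (use Wp pV in auto)
  define R where "R = A1 \<union> B1 - {q} - component E (A1 \<union> B1 - {q}) p"
  define S where "S = B1 \<union> A1 - {p} - component (adj B A col k) (B1 \<union> A1 - {p}) q"
  have R: "R = V - {q} - Wq" and S: "S = V - {p} - Wp"
    by (simp_all add: R_def S_def V_def Wq_def Wp_def adj_swap Un_commute)
  have q_full: "(\<forall>x\<in>X. col x q = d) \<or> (\<forall>x\<in>X. col x q = d')" using q by (simp add: full_B_def)
  have p_full: "(\<forall>x\<in>Y. col x p = d) \<or> (\<forall>x\<in>Y. col x p = d')" using p col_commute by (metis full_A_def)
  have R_A: "\<not> full_A a" if a: "a \<in> R \<inter> A1" for a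
  proof -
    have "\<forall>a\<in>R \<inter> A1. (\<exists>y\<in>Y. col a y = d) \<and> (\<exists>y\<in>Y. col a y = d')"
    proof -
      have "(\<exists>x\<in>X. col x b = d) \<and> (\<exists>x\<in>X. col x b = d')" if b: "b \<in> R \<inter> B1" for b
      proof (rule not_full_B)
        show "\<not> full_B b"
        proof
          assume "full_B b"
          moreover have "b \<in> Wp" using b R Rq_Wp by blast
          ultimately have "b \<in> K \<union> {q}" by (rule full_B_Wp)
          then show False using b R Wq by blast
        qed
      qed (use b in simp)
      then show ?thesis using bound_or_no_full_vertex[OF q(2) q_full p(2) R_def] neg by blast
    qed
    then have "(\<exists>y\<in>Y. col a y = d) \<and> (\<exists>y\<in>Y. col a y = d')" using a by blast
    then show ?thesis using kd by (fastforce simp: full_A_def)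
  qed
  have S_B: "\<not> full_B b" if b: "b \<in> S \<inter> B1" for b
  proof -
    have "\<forall>b\<in>S \<inter> B1. (\<exists>x\<in>X. col b x = d) \<and> (\<exists>x\<in>X. col b x = d')"
    proof -
      have "(\<exists>y\<in>Y. col y a = d) \<and> (\<exists>y\<in>Y. col y a = d')" if a: "a \<in> S \<inter> A1" for a
      proof -
        have "\<not> full_A a"
        proof
          assume "full_A a"
          moreover have "a \<in> Wq" using a S Rp_Wq by blast
          ultimately have "a \<in> K \<union> {p}" by (rule full_A_Wq)
          then show False using a S Wp by blast
        qed
        then show ?thesis using not_full_A[of a] a col_commute by (metis IntD2)
      qed
      then show ?thesis using sw.bound_or_no_full_vertex[OF p(2) p_full q(2) S_def] neg unfolding sw_eq
        by (simp add: add.commute) blast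
    qed
    then have "(\<exists>x\<in>X. col x b = d) \<and> (\<exists>x\<in>X. col x b = d')" using b col_commute by metis
    then show ?thesis using kd by (fastforce simp: full_B_def)
  qed
  obtain cp where cp: "cp = d \<or> cp = d'" "\<And>y. y \<in> Y \<Longrightarrow> col p y = cp" using p by (auto simp: full_A_def)
  obtain cq where cq: "cq = d \<or> cq = d'" "\<And>x. x \<in> X \<Longrightarrow> col x q = cq" using q by (auto simp: full_B_def)
  show False
  proof (rule full_pair_False[OF p(2) cp(2) q(2) cq(2) _ K(2)])
    show "K \<subseteq> A1 \<union> B1 - {p, q}" using K(1) by (simp add: V_def)
    show "\<exists>y\<in>Y. col a y = cp" if a: "a \<in> A1 - K - {p}" for a
    proof -
      have "\<not> full_A a"
      proof
        assume "full_A a"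
        then have "a \<notin> Wq" using full_A_Wq a by blast
        then have "a \<in> R \<inter> A1" using R a q A1_B1 by (auto simp: V_def)
        then show False using R_A \<open>full_A a\<close> by blast
      qed
      then show ?thesis using not_full_A[of a] a cp(1) by blast
    qed
    show "\<exists>x\<in>X. col x b = cq" if b: "b \<in> B1 - K - {q}" for b
    proof -
      have "\<not> full_B b"
      proof
        assume "full_B b"
        then have "b \<notin> Wp" using full_B_Wp b by blast
        then have "b \<in> S \<inter> B1" using S b p A1_B1 by (auto simp: V_def)
        then show False using S_B \<open>full_B b\<close> by blast
      qed
      then show ?thesis using not_full_B[of b] b cq(1) by blast
    qed
  qed
qed

end

section \<open>Labellings in which opposite vertices agree\<close>

text \<open>The label of a vertex for a color will be its component in that color, so the ends of every edge agree in
  the label of its color. If some color has at most three components, these components already are a partition.\<close>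

definition many :: "'v set \<Rightarrow> ('v \<Rightarrow> 'l) \<Rightarrow> bool" where
  "many S l \<longleftrightarrow> (\<forall>x y z. \<exists>v\<in>S. l v \<noteq> x \<and> l v \<noteq> y \<and> l v \<noteq> z)"

lemma manyD: "many S l \<Longrightarrow> \<exists>v\<in>S. l v \<noteq> x \<and> l v \<noteq> y \<and> l v \<noteq> z"
  by (simp add: many_def)

locale labels =
  fixes A B :: "'v set" and l1 l2 l3 :: "'v \<Rightarrow> 'l"
  assumes agree: "\<And>a b. a \<in> A \<Longrightarrow> b \<in> B \<Longrightarrow> l1 a = l1 b \<or> l2 a = l2 b \<or> l3 a = l3 b"
    and many_A: "many A l1" "many A l2" "many A l3"
    and many_B: "many B l1" "many B l2" "many B l3"
begin

lemma swap: "labels B A l1 l2 l3"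
  using agree many_A many_B by unfold_locales (metis, auto)

lemma rot: "labels A B l2 l3 l1"
  using agree many_A many_B by unfold_locales (metis, auto)

lemma flip: "labels A B l2 l1 l3"
  using agree many_A many_B by unfold_locales (metis, auto)

end

definition pair_cover :: "'v set \<Rightarrow> ('v \<Rightarrow> 'l) \<Rightarrow> ('v \<Rightarrow> 'l) \<Rightarrow> ('v \<Rightarrow> 'l) \<Rightarrow> bool" where
  "pair_cover S l1 l2 l3 \<longleftrightarrow> (\<exists>x y. (\<forall>v\<in>S. l1 v = x \<or> l2 v = y) \<or> (\<forall>v\<in>S. l1 v = x \<or> l3 v = y)
     \<or> (\<forall>v\<in>S. l2 v = x \<or> l3 v = y))"

section \<open>Two labels that cover all vertices\<close>

context labels
begin

text \<open>Since every \<open>a \<in> A\<close> agrees with both \<open>b\<close> and \<open>b'\<close>, at most one label of \<open>a\<close> differs from the labels of both.\<close>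

lemma third_label_determined:
  assumes b: "b \<in> B" "b' \<in> B" "l1 b \<noteq> l1 b'" "l2 b \<noteq> l2 b'" "l3 b \<noteq> l3 b'"
    and c: "c \<in> B" "l1 c \<noteq> l1 b" "l1 c \<noteq> l1 b'"
  shows "a \<in> A \<Longrightarrow> l3 a \<noteq> l3 b \<Longrightarrow> l3 a \<noteq> l3 b' \<Longrightarrow> l2 a = l2 c"
    and "a \<in> A \<Longrightarrow> l2 a \<noteq> l2 b \<Longrightarrow> l2 a \<noteq> l2 b' \<Longrightarrow> l3 a = l3 c"
proof -
  have off: "l1 a = l1 b \<and> l2 a = l2 b' \<or> l1 a = l1 b' \<and> l2 a = l2 b"
    if "a \<in> A" "l3 a \<noteq> l3 b" "l3 a \<noteq> l3 b'" for a
    using agree[OF that(1) b(1)] agree[OF that(1) b(2)] that b by metis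
  have off': "l1 a = l1 b \<and> l3 a = l3 b' \<or> l1 a = l1 b' \<and> l3 a = l3 b"
    if "a \<in> A" "l2 a \<noteq> l2 b" "l2 a \<noteq> l2 b'" for a
    using agree[OF that(1) b(1)] agree[OF that(1) b(2)] that b by metis
  \<comment> \<open>Here the fourth label is needed: \<open>l3 a3\<close> must avoid the label of
    \<open>c\<close> besides those of \<open>b\<close> and \<open>b'\<close>, which leaves
    \<open>l2\<close> as the only possible agreement of \<open>a3\<close> with
    \<open>c\<close>.\<close>
  obtain a3 where a3: "a3 \<in> A" "l3 a3 \<noteq> l3 b" "l3 a3 \<noteq> l3 b'" "l3 a3 \<noteq> l3 c"
    using manyD[OF many_A(3)] by metis
  have "l2 c = l2 b \<or> l2 c = l2 b'" using agree[OF a3(1) c(1)] off[OF a3(1-3)] a3 c by metis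
  then have l3: "l3 a = l3 c" if "a \<in> A" "l2 a \<noteq> l2 b" "l2 a \<noteq> l2 b'" for a
    using agree[OF that(1) c(1)] off'[OF that] that c by metis
  then show "a \<in> A \<Longrightarrow> l2 a \<noteq> l2 b \<Longrightarrow> l2 a \<noteq> l2 b' \<Longrightarrow> l3 a = l3 c" .
  obtain a2 where a2: "a2 \<in> A" "l2 a2 \<noteq> l2 b" "l2 a2 \<noteq> l2 b'" using manyD[OF many_A(2)] by metis
  have "l3 c = l3 b \<or> l3 c = l3 b'" using l3[OF a2] off'[OF a2] by metis
  then show "l2 a = l2 c" if "a \<in> A" "l3 a \<noteq> l3 b" "l3 a \<noteq> l3 b'"
    using agree[OF that(1) c(1)] off[OF that] that c by metis
qed

text \<open>A vertex of A with a label foreign to \<open>b\<close> and \<open>b'\<close> has its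
  other two labels prescribed. Each label is prescribed twice, and testing \<open>a1\<close>,
  \<open>a2\<close>, \<open>a3\<close> against \<open>c1\<close>, \<open>c2\<close>,
  \<open>c3\<close> shows that for at least two labels both prescriptions coincide; these values
  form the cover. A vertex whose labels all occur at \<open>b\<close> or \<open>b'\<close> cannot
  escape it, as it must agree with \<open>c1\<close>, \<open>c2\<close>, \<open>c3\<close>
  too.\<close>

lemma disjoint_pair_cover:
  assumes b: "b \<in> B" "b' \<in> B" "l1 b \<noteq> l1 b'" "l2 b \<noteq> l2 b'" "l3 b \<noteq> l3 b'"
  shows "pair_cover A l1 l2 l3"
proof -
  interpret r: labels A B l2 l3 l1 by (rule rot)
  interpret rr: labels A B l3 l1 l2 by (rule r.rot)
  obtain c1 where c1: "c1 \<in> B" "l1 c1 \<noteq> l1 b" "l1 c1 \<noteq> l1 b'" using manyD[OF many_B(1)] by metis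
  obtain c2 where c2: "c2 \<in> B" "l2 c2 \<noteq> l2 b" "l2 c2 \<noteq> l2 b'" using manyD[OF many_B(2)] by metis
  obtain c3 where c3: "c3 \<in> B" "l3 c3 \<noteq> l3 b" "l3 c3 \<noteq> l3 b'" using manyD[OF many_B(3)] by metis
  note d1 = third_label_determined[OF b c1]
  note d2 = r.third_label_determined[OF b(1,2,4,5,3) c2]
  note d3 = rr.third_label_determined[OF b(1,2,5,3,4) c3]
  have t3: "l1 v = l1 c2 \<and> l2 v = l2 c1" if "v \<in> A" "l3 v \<noteq> l3 b" "l3 v \<noteq> l3 b'" for v
    using d1(1)[OF that] d2(2)[OF that] by simp
  have t2: "l1 v = l1 c3 \<and> l3 v = l3 c1" if "v \<in> A" "l2 v \<noteq> l2 b" "l2 v \<noteq> l2 b'" for v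
    using d1(2)[OF that] d3(1)[OF that] by simp
  have t1: "l2 v = l2 c3 \<and> l3 v = l3 c2" if "v \<in> A" "l1 v \<noteq> l1 b" "l1 v \<noteq> l1 b'" for v
    using d2(1)[OF that] d3(2)[OF that] by simp
  obtain a3 where a3: "a3 \<in> A" "l3 a3 \<noteq> l3 b" "l3 a3 \<noteq> l3 b'" "l3 a3 \<noteq> l3 c3"
    using manyD[OF many_A(3)] by metis
  obtain a2 where a2: "a2 \<in> A" "l2 a2 \<noteq> l2 b" "l2 a2 \<noteq> l2 b'" "l2 a2 \<noteq> l2 c2"
    using manyD[OF many_A(2)] by metis
  obtain a1 where a1: "a1 \<in> A" "l1 a1 \<noteq> l1 b" "l1 a1 \<noteq> l1 b'" "l1 a1 \<noteq> l1 c1"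
    using manyD[OF many_A(1)] by metis
  have e3: "l1 c2 = l1 b \<and> l2 c1 = l2 b' \<or> l1 c2 = l1 b' \<and> l2 c1 = l2 b"
    using agree[OF a3(1) b(1)] agree[OF a3(1) b(2)] t3[OF a3(1-3)] a3 b by metis
  have e2: "l1 c3 = l1 b \<and> l3 c1 = l3 b' \<or> l1 c3 = l1 b' \<and> l3 c1 = l3 b"
    using agree[OF a2(1) b(1)] agree[OF a2(1) b(2)] t2[OF a2(1-3)] a2 b by metis
  have e1: "l2 c3 = l2 b \<and> l3 c2 = l3 b' \<or> l2 c3 = l2 b' \<and> l3 c2 = l3 b"
    using agree[OF a1(1) b(1)] agree[OF a1(1) b(2)] t1[OF a1(1-3)] a1 b by metis
  have f1: "l2 c1 = l2 c3 \<or> l3 c1 = l3 c2"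
    using agree[OF a1(1) c1(1)] t1[OF a1(1-3)] a1(4) by metis
  have f2: "l1 c2 = l1 c3 \<or> l3 c2 = l3 c1"
    using agree[OF a2(1) c2(1)] t2[OF a2(1-3)] a2(4) by metis
  have f3: "l1 c3 = l1 c2 \<or> l2 c3 = l2 c1"
    using agree[OF a3(1) c3(1)] t3[OF a3(1-3)] a3(4) by metis
  have ag: "(l1 v = l1 b \<or> l2 v = l2 b \<or> l3 v = l3 b) \<and> (l1 v = l1 b' \<or> l2 v = l2 b' \<or> l3 v = l3 b')
    \<and> (l1 v = l1 c1 \<or> l2 v = l2 c1 \<or> l3 v = l3 c1) \<and> (l1 v = l1 c2 \<or> l2 v = l2 c2 \<or> l3 v = l3 c2)
    \<and> (l1 v = l1 c3 \<or> l2 v = l2 c3 \<or> l3 v = l3 c3)" if "v \<in> A" for v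
    using agree[OF that] b(1,2) c1(1) c2(1) c3(1) by blast
  consider "l1 c2 = l1 c3" "l2 c1 = l2 c3" | "l1 c2 = l1 c3" "l3 c1 = l3 c2" | "l2 c1 = l2 c3" "l3 c1 = l3 c2"
    using f1 f2 f3 by metis
  then show ?thesis
  proof cases
    case 1
    have "l1 v = l1 c2 \<or> l2 v = l2 c1" if v: "v \<in> A" for v
      using ag[OF v] t1[OF v] t2[OF v] t3[OF v] 1 e1 e2 e3 b c1 c2 c3 by metis
    then show ?thesis unfolding pair_cover_def by blast
  next
    case 2
    have "l1 v = l1 c2 \<or> l3 v = l3 c1" if v: "v \<in> A" for v
      using ag[OF v] t1[OF v] t2[OF v] t3[OF v] 2 e1 e2 e3 b c1 c2 c3 by metis
    then show ?thesis unfolding pair_cover_def by blast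
  next
    case 3
    have "l2 v = l2 c1 \<or> l3 v = l3 c1" if v: "v \<in> A" for v
      using ag[OF v] t1[OF v] t2[OF v] t3[OF v] 3 e1 e2 e3 b c1 c2 c3 by metis
    then show ?thesis unfolding pair_cover_def by blast
  qed
qed

text \<open>If B is not covered, a vertex \<open>a\<close> has three partners in B, each agreeing
  with it in a different single label. If A is not covered either, any two vertices of B agree
  somewhere, which ties the partners together pairwise; a vertex of B with a new first label then
  cannot agree with \<open>a\<close> and all three.\<close>

lemma cover_A_or_B: "pair_cover A l1 l2 l3 \<or> pair_cover B l1 l2 l3"
proof -
  obtain a where a: "a \<in> A" using manyD[OF many_A(1)] by blast
  show ?thesis
  proof (cases "pair_cover B l1 l2 l3")
    case False
    obtain b1 b2 b3 where b: "b1 \<in> B" "b2 \<in> B" "b3 \<in> B"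
      and b1: "l2 b1 = l2 a" "l1 b1 \<noteq> l1 a" "l3 b1 \<noteq> l3 a"
      and b2: "l3 b2 = l3 a" "l1 b2 \<noteq> l1 a" "l2 b2 \<noteq> l2 a"
      and b3: "l1 b3 = l1 a" "l2 b3 \<noteq> l2 a" "l3 b3 \<noteq> l3 a"
      using False agree[OF a] unfolding pair_cover_def by metis
    show ?thesis
    proof (rule ccontr)
      assume no: "\<not> ?thesis"
      have meet: "l1 b = l1 b' \<or> l2 b = l2 b' \<or> l3 b = l3 b'" if "b \<in> B" "b' \<in> B" for b b'
        using disjoint_pair_cover[OF that] no by blast
      obtain v where v: "v \<in> B" "l1 v \<noteq> l1 a" "l1 v \<noteq> l1 b1" using manyD[OF many_B(1)] by metis
      have "l1 b1 = l1 b2" "l2 b2 = l2 b3" "l3 b1 = l3 b3"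
        using meet[of b1 b2] meet[of b2 b3] meet[of b1 b3] b b1 b2 b3 by metis+
      then show False
        using meet[OF v(1) b(1)] meet[OF v(1) b(2)] meet[OF v(1) b(3)] agree[OF a v(1)] v b1 b2 b3 by metis
    qed
  qed blast
qed

text \<open>If some \<open>a0\<close> escapes the cover, its third label replaces \<open>x\<close>
  or \<open>y\<close>. Which one is decided by a vertex \<open>b'\<close> with a different third
  label: it agrees with \<open>a0\<close> in the first label, and \<open>x\<close> is replaced, or
  in the second, and \<open>y\<close> is.\<close>

lemma extend_cover_12:
  assumes cov: "\<And>b. b \<in> B \<Longrightarrow> l1 b = x \<or> l2 b = y"
  shows "pair_cover (A \<union> B) l1 l2 l3"
proof (cases "\<exists>a\<in>A. l1 a \<noteq> x \<and> l2 a \<noteq> y")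
  case False
  then have "\<forall>v\<in>A \<union> B. l1 v = x \<or> l2 v = y" using cov by blast
  then show ?thesis unfolding pair_cover_def by blast
next
  case True
  then obtain a0 where a0: "a0 \<in> A" "l1 a0 \<noteq> x" "l2 a0 \<noteq> y" by blast
  obtain b' where b': "b' \<in> B" "l3 b' \<noteq> l3 a0" using manyD[OF many_B(3)] by metis
  have third: "l3 a = l3 a0" if a: "a \<in> A" "l1 a \<noteq> x" "l2 a \<noteq> y" for a
  proof -
    obtain b where "b \<in> B" "l1 b \<noteq> x" "l1 b \<noteq> l1 a0" "l1 b \<noteq> l1 a" using manyD[OF many_B(1)] by metis
    then show ?thesis using agree[OF a(1)] agree[OF a0(1)] cov a a0 by metis
  qed
  have "l1 b' = l1 a0 \<or> l2 b' = l2 a0" using agree[OF a0(1) b'(1)] b' by metis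
  then show ?thesis
  proof
    assume 1: "l1 b' = l1 a0"
    have b'y: "l2 b' = y" using cov[OF b'(1)] 1 a0 by metis
    obtain a where a: "a \<in> A" "l1 a \<noteq> x" "l1 a \<noteq> l1 a0" using manyD[OF many_A(1)] by metis
    have ay: "l2 a = y" using third[OF a(1,2)] agree[OF a(1) b'(1)] a 1 b' b'y by metis
    obtain b2 where b2: "b2 \<in> B" "l2 b2 \<noteq> y" "l2 b2 \<noteq> l2 a0" using manyD[OF many_B(2)] by metis
    have b2x: "l1 b2 = x" using cov b2 by metis
    have b2t: "l3 b2 = l3 a0" using agree[OF a0(1) b2(1)] b2 b2x a0 by metis
    have at: "l3 a = l3 a0" using agree[OF a(1) b2(1)] b2 b2x b2t a ay by metis
    have "l2 v = y \<or> l3 v = l3 a0" if "v \<in> B" for v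
      using agree[OF a(1) that] cov[OF that] a ay at by metis
    moreover have "l2 v = y \<or> l3 v = l3 a0" if v: "v \<in> A" for v
    proof (cases "l1 v = x")
      case True
      obtain b where b: "b \<in> B" "l1 b \<noteq> x" "l1 b \<noteq> l1 a0" using manyD[OF many_B(1)] by metis
      then show ?thesis using agree[OF v b(1)] agree[OF a0(1) b(1)] cov[OF b(1)] a0 True by metis
    next
      case False
      then show ?thesis using third[OF v] by blast
    qed
    ultimately show ?thesis unfolding pair_cover_def by blast
  next
    assume 2: "l2 b' = l2 a0"
    have b'x: "l1 b' = x" using cov[OF b'(1)] 2 a0 by metis
    obtain a where a: "a \<in> A" "l2 a \<noteq> y" "l2 a \<noteq> l2 a0" using manyD[OF many_A(2)] by metis
    have ax: "l1 a = x" using third[OF a(1)] agree[OF a(1) b'(1)] a 2 b' b'x by metis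
    obtain b1 where b1: "b1 \<in> B" "l1 b1 \<noteq> x" "l1 b1 \<noteq> l1 a0" using manyD[OF many_B(1)] by metis
    have b1y: "l2 b1 = y" using cov b1 by metis
    have b1t: "l3 b1 = l3 a0" using agree[OF a0(1) b1(1)] b1 b1y a0 by metis
    have at: "l3 a = l3 a0" using agree[OF a(1) b1(1)] b1 b1y b1t a ax by metis
    have "l1 v = x \<or> l3 v = l3 a0" if "v \<in> B" for v
      using agree[OF a(1) that] cov[OF that] a ax at by metis
    moreover have "l1 v = x \<or> l3 v = l3 a0" if v: "v \<in> A" for v
    proof (cases "l2 v = y")
      case True
      obtain b where b: "b \<in> B" "l2 b \<noteq> y" "l2 b \<noteq> l2 a0" using manyD[OF many_B(2)] by metis
      then show ?thesis using agree[OF v b(1)] agree[OF a0(1) b(1)] cov[OF b(1)] a0 True by metis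
    next
      case False
      then show ?thesis using third[OF v] by blast
    qed
    ultimately show ?thesis unfolding pair_cover_def by blast
  qed
qed


lemma extend_cover:
  assumes "pair_cover B l1 l2 l3"
  shows "pair_cover (A \<union> B) l1 l2 l3"
proof -
  interpret r: labels A B l2 l3 l1 by (rule rot)
  interpret rr: labels A B l3 l1 l2 by (rule r.rot)
  interpret f: labels A B l1 l3 l2 by (rule rr.flip)
  obtain x y where "(\<forall>v\<in>B. l1 v = x \<or> l2 v = y) \<or> (\<forall>v\<in>B. l1 v = x \<or> l3 v = y) \<or> (\<forall>v\<in>B. l2 v = x \<or> l3 v = y)"
    using assms unfolding pair_cover_def by blast
  then show ?thesis
  proof (elim disjE)
    assume c: "\<forall>v\<in>B. l1 v = x \<or> l2 v = y"
    show ?thesis by (rule extend_cover_12[OF bspec[OF c]])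
  next
    assume c: "\<forall>v\<in>B. l1 v = x \<or> l3 v = y"
    have "pair_cover (A \<union> B) l1 l3 l2" by (rule f.extend_cover_12[OF bspec[OF c]])
    then show ?thesis unfolding pair_cover_def by metis
  next
    assume c: "\<forall>v\<in>B. l2 v = x \<or> l3 v = y"
    have "pair_cover (A \<union> B) l2 l3 l1" by (rule r.extend_cover_12[OF bspec[OF c]])
    then show ?thesis unfolding pair_cover_def by metis
  qed
qed

lemma pair_cover_both: "pair_cover (A \<union> B) l1 l2 l3"
proof -
  interpret sw: labels B A l1 l2 l3 by (rule swap)
  show ?thesis using cover_A_or_B extend_cover sw.extend_cover by (metis Un_commute)
qed

end

section \<open>Partition into three monochromatic connected sets\<close>

locale three_colored = bipartite_coloring A B col
  for A B :: "'v set" and col +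
  assumes col_range: "\<And>a b. a \<in> A \<Longrightarrow> b \<in> B \<Longrightarrow> col a b \<in> {0, 1, 2}"
    and deg_A: "\<And>a k. a \<in> A \<Longrightarrow> k \<in> {0, 1, 2} \<Longrightarrow> \<exists>b\<in>B. col a b = k"
    and deg_B: "\<And>b k. b \<in> B \<Longrightarrow> k \<in> {0, 1, 2} \<Longrightarrow> \<exists>a\<in>A. col a b = k"
    and not_three: "\<not> three_parts A B col"
begin

definition label :: "nat \<Rightarrow> 'v \<Rightarrow> 'v set" where
  "label k v = component (adj A B col k) (A \<union> B) v"

lemma label_conn: "v \<in> A \<union> B \<Longrightarrow> conn (adj A B col k) (label k v)"
  unfolding label_def by (rule component_conn)

lemma label_refl: "v \<in> A \<union> B \<Longrightarrow> v \<in> label k v"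
  unfolding label_def by (rule component_refl)

lemma label_sub: "label k v \<subseteq> A \<union> B"
  unfolding label_def by (rule component_subset)

lemma label_eq:
  assumes "u \<in> label k v" "v \<in> A \<union> B"
  shows "label k u = label k v"
proof
  have u: "u \<in> A \<union> B" using assms label_sub by blast
  show "label k v \<subseteq> label k u"
    using component_max[OF label_conn[OF assms(2)] label_sub assms(1)] by (simp add: label_def)
  then have "v \<in> label k u" using label_refl[OF assms(2)] by blast
  then show "label k u \<subseteq> label k v"
    using component_max[OF label_conn[OF u] label_sub] by (simp add: label_def)
qed

lemma label_class: "v \<in> A \<union> B \<Longrightarrow> {u \<in> A \<union> B. label k u = label k v} = label k v"
  using label_eq label_refl label_sub by blast

lemma label_edge:
  assumes "a \<in> A" "b \<in> B" "col a b = k"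
  shows "label k a = label k b"
proof (rule label_eq)
  have "b \<in> label k b" using assms label_refl by blast
  then show "a \<in> label k b"
    unfolding label_def
    by (rule component_closed[OF adj_symp, rotated]) (use assms adjI'[OF assms] in auto)
qed (use assms in blast)

lemma label_class_mono: "monochromatic A B col {u \<in> A \<union> B. label k u = x}"
proof (cases "\<exists>v\<in>A \<union> B. label k v = x")
  case True
  then obtain v where v: "v \<in> A \<union> B" "x = label k v" by blast
  then show ?thesis using monochromaticI[OF label_conn[OF v(1)]] label_class[OF v(1)] by simp
next
  case False
  then have "{u \<in> A \<union> B. label k u = x} = {}" by blast
  then show ?thesis unfolding monochromatic_def by blast
qed

text \<open>The classes of a label are monochromatic, so three of them cannot exhaust the graph. A
  fourth label found on the wrong side is carried over by an edge of color \<open>k\<close>.\<close>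

lemma many_labels:
  assumes k: "k \<in> {0, 1, 2}"
  shows "many A (label k)" "many B (label k)"
proof -
  have no: False if "\<And>v. v \<in> A \<union> B \<Longrightarrow> label k v = x \<or> label k v = y \<or> label k v = z" for x y z
  proof -
    \<comment> \<open>The set F removes repetitions, so that the three parts are disjoint even if x,
      y, z are not distinct.\<close>
    have sub: "monochromatic A B col {u \<in> A \<union> B. label k u = w \<and> label k u \<notin> F}" for w F
    proof (cases "w \<in> F")
      case True
      then have "{u \<in> A \<union> B. label k u = w \<and> label k u \<notin> F} = {}" by blast
      then show ?thesis unfolding monochromatic_def by blast
    next
      case False
      then have "{u \<in> A \<union> B. label k u = w \<and> label k u \<notin> F} = {u \<in> A \<union> B. label k u = w}" by blast
      then show ?thesis using label_class_mono by simp
    qed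
    have "three_parts A B col"
    proof (rule three_partsI[OF _ _ _ _ sub[of x "{}"] sub[of y "{x}"] sub[of z "{x, y}"]])
      show "A \<union> B = {u \<in> A \<union> B. label k u = x \<and> label k u \<notin> {}} \<union> {u \<in> A \<union> B. label k u = y \<and> label k u \<notin> {x}} \<union>
          {u \<in> A \<union> B. label k u = z \<and> label k u \<notin> {x, y}}" using that by auto
    qed auto
    then show False using not_three by simp
  qed
  show "many A (label k)"
    unfolding many_def
  proof (intro allI)
    fix x y z
    obtain v where v: "v \<in> A \<union> B" "label k v \<noteq> x" "label k v \<noteq> y" "label k v \<noteq> z" using no[of x y z] by blast
    show "\<exists>v\<in>A. label k v \<noteq> x \<and> label k v \<noteq> y \<and> label k v \<noteq> z"
    proof (cases "v \<in> A")
      case False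
      then obtain a where "a \<in> A" "col a v = k" using deg_B[of v k] v k by blast
      then have "label k a = label k v" using label_edge[of a v k] v False by blast
      then show ?thesis using v \<open>a \<in> A\<close> by auto
    qed (use v in blast)
  qed
  show "many B (label k)"
    unfolding many_def
  proof (intro allI)
    fix x y z
    obtain v where v: "v \<in> A \<union> B" "label k v \<noteq> x" "label k v \<noteq> y" "label k v \<noteq> z" using no[of x y z] by blast
    show "\<exists>v\<in>B. label k v \<noteq> x \<and> label k v \<noteq> y \<and> label k v \<noteq> z"
    proof (cases "v \<in> B")
      case False
      then obtain b where "b \<in> B" "col v b = k" using deg_A[of v k] v k by blast
      then have "label k v = label k b" using label_edge[of v b k] v False by blast
      then show ?thesis using v \<open>b \<in> B\<close> by auto
    qed (use v in blast)
  qed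
qed

lemma labels_label: "labels A B (label 0) (label 1) (label 2)"
proof unfold_locales
  fix a b assume "a \<in> A" "b \<in> B"
  then show "label 0 a = label 0 b \<or> label 1 a = label 1 b \<or> label 2 a = label 2 b"
    using col_range[of a b] label_edge[of a b "col a b"] by auto
qed (simp_all add: many_labels)

text \<open>Otherwise the class \<open>t1\<close> of color \<open>k3\<close> splits the graph: no edge of color \<open>k3\<close> leaves it, and exchanging the
  sides of the class leads to two complete bipartite graphs, spanned by trees of colors \<open>k1\<close> and \<open>k2\<close>.\<close>

lemma third_labels_equal:
  assumes k: "{k1, k2, k3} = {0, 1, 2}" "k1 \<noteq> k2" "k1 \<noteq> k3" "k2 \<noteq> k3"
    and cov: "\<And>v. v \<in> A \<union> B \<Longrightarrow> label k1 v = x \<or> label k2 v = y"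
    and tA: "\<And>a. a \<in> A \<Longrightarrow> label k1 a \<noteq> x \<Longrightarrow> label k3 a = t1" and tB: "\<And>b. b \<in> B \<Longrightarrow> label k2 b \<noteq> y \<Longrightarrow> label k3 b = t1"
    and tA': "\<And>a. a \<in> A \<Longrightarrow> label k2 a \<noteq> y \<Longrightarrow> label k3 a = t2" and tB': "\<And>b. b \<in> B \<Longrightarrow> label k1 b \<noteq> x \<Longrightarrow> label k3 b = t2"
    and t: "t1 \<noteq> t2"
  shows False
proof -
  have col: "col a b = k1 \<or> col a b = k2 \<or> col a b = k3" if "a \<in> A" "b \<in> B" for a b
    using col_range[OF that] k(1) by (metis insertE singletonD)
  have colors: "k1 \<in> {0, 1, 2}" "k2 \<in> {0, 1, 2}" "k3 \<in> {0, 1, 2}" using k(1) by blast+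
  note many1 = many_labels[OF colors(1)] and many2 = many_labels[OF colors(2)]
    and many3 = many_labels[OF colors(3)]
  have c1: "col a b = k1" if "a \<in> A" "b \<in> B" "label k2 a \<noteq> label k2 b" "label k3 a \<noteq> label k3 b" for a b
    using col[OF that(1,2)] label_edge[OF that(1,2)] that by metis
  have c2: "col a b = k2" if "a \<in> A" "b \<in> B" "label k1 a \<noteq> label k1 b" "label k3 a \<noteq> label k3 b" for a b
    using col[OF that(1,2)] label_edge[OF that(1,2)] that by metis
  obtain a0 where a0: "a0 \<in> A" "label k3 a0 \<noteq> t1" "label k3 a0 \<noteq> t2" using manyD[OF many3(1)] by metis
  have a0xy: "label k1 a0 = x" "label k2 a0 = y" using tA[OF a0(1)] tA'[OF a0(1)] a0 by blast+
  obtain b0 where b0: "b0 \<in> B" "label k3 b0 \<noteq> t1" "label k3 b0 \<noteq> t2" using manyD[OF many3(2)] by metis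
  have b0xy: "label k1 b0 = x" "label k2 b0 = y" using tB[OF b0(1)] tB'[OF b0(1)] b0 by blast+
  let ?T1 = "{a \<in> A. label k3 a \<noteq> t1} \<union> {b \<in> B. label k3 b = t1}"
  let ?T2 = "{b \<in> B. label k3 b \<noteq> t1} \<union> {a \<in> A. label k3 a = t1}"
  \<comment> \<open>\<open>a0\<close> lies in both covering components and has a label for
    \<open>k3\<close> other than \<open>t1\<close>. A vertex \<open>b\<close> whose label for
    \<open>k2\<close> is not \<open>y\<close> has label \<open>t1\<close> for \<open>k3\<close>, so
    its edge to \<open>a0\<close> can only have color \<open>k1\<close>.\<close>
  have "conn (adj A B col k1) ({a0} \<union> {b \<in> B. label k2 b \<noteq> y})"
  proof (rule conn_attach_B[OF conn_singleton])
    show "\<exists>s\<in>{a0} \<inter> A. col s b = k1" if "b \<in> {b \<in> B. label k2 b \<noteq> y}" for b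
      using that a0 a0xy tB c1[of a0 b] by auto
  qed blast
  then have "conn (adj A B col k1) ({a0} \<union> {b \<in> B. label k2 b \<noteq> y} \<union> {a \<in> A. label k3 a \<noteq> t1})"
  proof (rule conn_attach_A)
    fix a assume a: "a \<in> {a \<in> A. label k3 a \<noteq> t1}"
    obtain b where b: "b \<in> B" "label k2 b \<noteq> y" "label k2 b \<noteq> label k2 a" using manyD[OF many2(2)] by metis
    then have "col a b = k1" using a tB c1[of a b] by auto
    then show "\<exists>s\<in>({a0} \<union> {b \<in> B. label k2 b \<noteq> y}) \<inter> B. col a s = k1" using b by blast
  qed blast
  then have "conn (adj A B col k1) ({a0} \<union> {b \<in> B. label k2 b \<noteq> y} \<union> {a \<in> A. label k3 a \<noteq> t1} \<union> {b \<in> B. label k3 b = t1})"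
  proof (rule conn_attach_B)
    fix b assume b: "b \<in> {b \<in> B. label k3 b = t1}"
      "b \<notin> {a0} \<union> {b \<in> B. label k2 b \<noteq> y} \<union> {a \<in> A. label k3 a \<noteq> t1}"
    obtain a where a: "a \<in> A" "label k2 a \<noteq> y" using manyD[OF many2(1)] by metis
    then have "label k3 a = t2" using tA' by blast
    then have "col a b = k1" using a b t c1[of a b] by auto
    then show "\<exists>s\<in>({a0} \<union> {b \<in> B. label k2 b \<noteq> y} \<union> {a \<in> A. label k3 a \<noteq> t1}) \<inter> A. col s b = k1"
      using a \<open>label k3 a = t2\<close> t by auto
  qed blast
  moreover have "{a0} \<union> {b \<in> B. label k2 b \<noteq> y} \<union> {a \<in> A. label k3 a \<noteq> t1} \<union> {b \<in> B. label k3 b = t1} = ?T1"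
    using a0 tB by auto
  ultimately have "conn (adj A B col k1) ?T1" by (simp only:)
  then have T1: "monochromatic A B col ?T1" by (rule monochromaticI)
  have "conn (adj A B col k2) ({b0} \<union> {a \<in> A. label k1 a \<noteq> x})"
  proof (rule conn_attach_A[OF conn_singleton])
    show "\<exists>s\<in>{b0} \<inter> B. col a s = k2" if "a \<in> {a \<in> A. label k1 a \<noteq> x}" for a
      using that b0 b0xy tA c2[of a b0] by auto
  qed blast
  then have "conn (adj A B col k2) ({b0} \<union> {a \<in> A. label k1 a \<noteq> x} \<union> {b \<in> B. label k3 b \<noteq> t1})"
  proof (rule conn_attach_B)
    fix b assume b: "b \<in> {b \<in> B. label k3 b \<noteq> t1}"
    obtain a where a: "a \<in> A" "label k1 a \<noteq> x" "label k1 a \<noteq> label k1 b" using manyD[OF many1(1)] by metis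
    then have "col a b = k2" using b tA c2[of a b] by auto
    then show "\<exists>s\<in>({b0} \<union> {a \<in> A. label k1 a \<noteq> x}) \<inter> A. col s b = k2" using a by blast
  qed blast
  then have "conn (adj A B col k2) ({b0} \<union> {a \<in> A. label k1 a \<noteq> x} \<union> {b \<in> B. label k3 b \<noteq> t1} \<union> {a \<in> A. label k3 a = t1})"
  proof (rule conn_attach_A)
    fix a assume a: "a \<in> {a \<in> A. label k3 a = t1}"
      "a \<notin> {b0} \<union> {a \<in> A. label k1 a \<noteq> x} \<union> {b \<in> B. label k3 b \<noteq> t1}"
    obtain b where b: "b \<in> B" "label k1 b \<noteq> x" using manyD[OF many1(2)] by metis
    then have "label k3 b = t2" using tB' by blast
    then have "col a b = k2" using a b t c2[of a b] by auto
    then show "\<exists>s\<in>({b0} \<union> {a \<in> A. label k1 a \<noteq> x} \<union> {b \<in> B. label k3 b \<noteq> t1}) \<inter> B. col a s = k2"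
      using b \<open>label k3 b = t2\<close> t by auto
  qed blast
  moreover have "{b0} \<union> {a \<in> A. label k1 a \<noteq> x} \<union> {b \<in> B. label k3 b \<noteq> t1} \<union> {a \<in> A. label k3 a = t1} = ?T2"
    using b0 tA by auto
  ultimately have "conn (adj A B col k2) ?T2" by (simp only:)
  then have T2: "monochromatic A B col ?T2" by (rule monochromaticI)
  have "monochromatic A B col {}" by (simp add: monochromatic_def)
  then have "three_parts A B col"
    using AB by (intro three_partsI[OF _ _ _ _ T1 T2]) auto
  then show False using not_three by simp
qed

end

text \<open>The remaining case: one component per color such that every vertex lies in at least two of the three.\<close>

locale big_components = three_colored A B col
  for A B :: "'v set" and col +
  fixes big :: "nat \<Rightarrow> 'v set"
  assumes big: "\<And>v k k'. v \<in> A \<union> B \<Longrightarrow> k \<in> {0, 1, 2} \<Longrightarrow> k' \<in> {0, 1, 2} \<Longrightarrow> k \<noteq> k' \<Longrightarrow>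
      label k v = big k \<or> label k' v = big k'"
    and balanced: "card A = card B"
begin

section \<open>Vertices outside one of the three components\<close>

definition outside :: "nat \<Rightarrow> 'v set \<Rightarrow> 'v set" where
  "outside k S = {v \<in> S. label k v \<noteq> big k}"

lemma outside_disjoint:
  assumes "S = A \<or> S = B" "i \<noteq> j" "i \<in> {0, 1, 2}" "j \<in> {0, 1, 2}"
  shows "outside i S \<inter> outside j S = {}"
proof -
  have "\<not> (v \<in> outside i S \<and> v \<in> outside j S)" for v
    using big[of v i j] assms by (auto simp only: outside_def mem_Collect_eq)
  then show ?thesis by blast
qed

lemma card_outside:
  assumes "k \<in> {0, 1, 2}" "S = A \<or> S = B"
  shows "3 \<le> card (outside k S)"
proof -
  have many: "many S (label k)" using many_labels assms by blast
  obtain u where u: "u \<in> S" "label k u \<noteq> big k" using manyD[OF many] by metis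
  obtain v where v: "v \<in> S" "label k v \<noteq> big k" "label k v \<noteq> label k u" using manyD[OF many] by metis
  obtain w where w: "w \<in> S" "label k w \<noteq> big k" "label k w \<noteq> label k u" "label k w \<noteq> label k v" using manyD[OF many] by metis
  have "{u, v, w} \<subseteq> outside k S" "card {u, v, w} = 3"
    using u v w by (auto simp: outside_def card_insert_if)
  moreover have "finite (outside k S)" using assms fin_A fin_B by (auto simp: outside_def)
  ultimately show ?thesis using card_mono by metis
qed

text \<open>Without such an edge, opposite vertices outside \<open>big k\<close> in different
  components of color \<open>k\<close> are joined in color d'. As at least three components remain
  outside, this connects the whole complement of the component in color d', and two parts
  suffice.\<close>

lemma outside_edge:
  assumes k: "{k, d, d'} = {0, 1, 2}" "k \<noteq> d" "k \<noteq> d'" "d \<noteq> d'"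
  shows "\<exists>x\<in>outside k A. \<exists>y\<in>outside k B. col x y = d"
proof (rule ccontr)
  assume no: "\<not> ?thesis"
  have colors: "k \<in> {0, 1, 2}" "d \<in> {0, 1, 2}" "d' \<in> {0, 1, 2}" using k(1) by blast+
  note many = many_labels[OF colors(1)]
  have c: "col a b = d'" if "a \<in> outside k A" "b \<in> outside k B" "label k a \<noteq> label k b" for a b
  proof -
    have ab: "a \<in> A" "b \<in> B" using that by (auto simp: outside_def)
    have "col a b = k \<or> col a b = d \<or> col a b = d'" using col_range[OF ab] k(1) by (metis insertE singletonD)
    then show ?thesis using no that label_edge[OF ab] by blast
  qed
  obtain x0 where x0: "x0 \<in> A" "label k x0 \<noteq> big k" using manyD[OF many(1)] by metis
  let ?Y0 = "{y \<in> outside k B. label k y \<noteq> label k x0}"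
  have "conn (adj A B col d') ({x0} \<union> ?Y0)"
    by (rule conn_attach_B[OF conn_singleton]) (use x0 c in \<open>auto simp: outside_def\<close>)
  then have "conn (adj A B col d') ({x0} \<union> ?Y0 \<union> outside k A)"
  proof (rule conn_attach_A)
    fix a assume a: "a \<in> outside k A"
    obtain y where "y \<in> B" "label k y \<noteq> big k" "label k y \<noteq> label k x0" "label k y \<noteq> label k a" using manyD[OF many(2)] by metis
    then show "\<exists>s\<in>({x0} \<union> ?Y0) \<inter> B. col a s = d'" using c[OF a, of y] by (auto simp: outside_def)
  qed (auto simp: outside_def)
  then have "conn (adj A B col d') ({x0} \<union> ?Y0 \<union> outside k A \<union> outside k B)"
  proof (rule conn_attach_B)
    fix b assume b: "b \<in> outside k B"
    obtain x where "x \<in> A" "label k x \<noteq> big k" "label k x \<noteq> label k b" using manyD[OF many(1)] by metis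
    then show "\<exists>s\<in>({x0} \<union> ?Y0 \<union> outside k A) \<inter> A. col s b = d'" using c[of x b] b by (auto simp: outside_def)
  qed (auto simp: outside_def)
  moreover have "{x0} \<union> ?Y0 \<union> outside k A \<union> outside k B = {v \<in> A \<union> B. label k v \<noteq> big k}"
    using x0 by (auto simp: outside_def)
  ultimately have "conn (adj A B col d') {v \<in> A \<union> B. label k v \<noteq> big k}" by (simp only:)
  then have m: "monochromatic A B col {v \<in> A \<union> B. label k v \<noteq> big k}" by (rule monochromaticI)
  have "monochromatic A B col {}" by (simp add: monochromatic_def)
  then have "three_parts A B col"
    by (rule three_partsI[OF _ _ _ _ label_class_mono[of k "big k"] m, rotated 4]) blast+
  then show False using not_three by simp
qed

text \<open>For distinct i and j, an edge between a vertex outside \<open>big i\<close> and an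
  opposite vertex outside \<open>big j\<close> has neither of these colors, as each end lies in the
  component that the other one misses. Hence the vertices missing d' are those that send only color
  \<open>d\<close> to the complement of \<open>big k\<close>, which explains the crossed order of
  the arguments.\<close>

lemma main_color_outside:
  assumes k: "{k, d, d'} = {0, 1, 2}" "k \<noteq> d" "k \<noteq> d'" "d \<noteq> d'"
  shows "main_color A B col k d d' (A - outside k A) (outside k A) (B - outside k B) (outside k B)
    (outside d' A) (outside d A) (outside d' B) (outside d B)"
proof -
  have colors: "k \<in> {0, 1, 2}" "d \<in> {0, 1, 2}" "d' \<in> {0, 1, 2}" using k(1) by blast+
  have col: "col a b \<in> {k, d, d'}" if "a \<in> A" "b \<in> B" for a b
    using col_range[OF that] k(1) by metis
  have ne: "col a b \<noteq> j" if "a \<in> A" "b \<in> B" "(a \<in> outside j A) \<noteq> (b \<in> outside j B)" for a b j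
    using label_edge[OF that(1,2)] that by (auto simp: outside_def)
  have dis: "v \<notin> outside j S" if "v \<in> outside i S" "S = A \<or> S = B" "i \<noteq> j" "i \<in> {0, 1, 2}" "j \<in> {0, 1, 2}" for v i j S
    using big[of v i j] that by (auto simp: outside_def)
  have sub: "outside j S \<subseteq> S" for j S by (auto simp: outside_def)
  have sd: "outside i S \<subseteq> S - outside j S" "outside i S \<inter> outside j S = {}"
    if "S = A \<or> S = B" "i \<noteq> j" "i \<in> {0, 1, 2}" "j \<in> {0, 1, 2}" for i j S
    using dis[OF _ that] sub by blast+
  show ?thesis
  proof unfold_locales
    show "conn (adj A B col k) (A - outside k A \<union> (B - outside k B))"
    proof -
      obtain v where v: "v \<in> A" "label d v \<noteq> big d" using manyD[OF many_labels(1)[OF colors(2)]] by metis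
      then have "label k v = big k" using big[of v k d] colors k by auto
      then have "{u \<in> A \<union> B. label k u = big k} = label k v" using label_class[of v k] v by simp
      moreover have "A - outside k A \<union> (B - outside k B) = {u \<in> A \<union> B. label k u = big k}"
        by (auto simp: outside_def)
      ultimately show ?thesis using label_conn[of v k] v by simp
    qed
    show "\<exists>x\<in>outside k A. \<exists>y\<in>outside k B. col x y = d" by (rule outside_edge[OF k])
    show "\<exists>x\<in>outside k A. \<exists>y\<in>outside k B. col x y = d'"
      using outside_edge[of k d' d] k by (metis insert_commute)
    show "col a b = d" if "a \<in> outside d' A" "b \<in> outside k B" for a b
      using col[of a b] ne[of a b k] ne[of a b d'] dis[OF that(1), of k] dis[OF that(2), of d'] that sub k colors by blast
    show "col a b = d'" if "a \<in> outside d A" "b \<in> outside k B" for a b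
      using col[of a b] ne[of a b k] ne[of a b d] dis[OF that(1), of k] dis[OF that(2), of d] that sub k colors by blast
    show "col a b = d" if "a \<in> outside k A" "b \<in> outside d' B" for a b
      using col[of a b] ne[of a b k] ne[of a b d'] dis[OF that(1), of d'] dis[OF that(2), of k] that sub k colors by blast
    show "col a b = d'" if "a \<in> outside k A" "b \<in> outside d B" for a b
      using col[of a b] ne[of a b k] ne[of a b d] dis[OF that(1), of d] dis[OF that(2), of k] that sub k colors by blast
    show "col a b = k" if "a \<in> outside d' A" "b \<in> outside d B" for a b
      using col[of a b] ne[of a b d'] ne[of a b d] dis[OF that(1), of d] dis[OF that(2), of d'] that sub k colors by blast
    show "col a b = k" if "a \<in> outside d A" "b \<in> outside d' B" for a b
      using col[of a b] ne[of a b d'] ne[of a b d] dis[OF that(1), of d'] dis[OF that(2), of d] that sub k colors by blast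
    show "col a b \<noteq> k" if "a \<in> A - outside k A" "b \<in> outside k B" for a b
      using ne[of a b k] that sub by blast
    show "col a b \<noteq> k" if "a \<in> outside k A" "b \<in> B - outside k B" for a b
      using ne[of a b k] that sub by blast
    show "outside d' A \<subseteq> A - outside k A" "outside d A \<subseteq> A - outside k A"
      "outside d' B \<subseteq> B - outside k B" "outside d B \<subseteq> B - outside k B"
      by (rule sd(1); use k colors in simp)+
    show "outside d' A \<inter> outside d A = {}" "outside d' B \<inter> outside d B = {}"
      by (rule sd(2); use k colors in simp)+
    show "col a b \<in> {k, d, d'}" if "a \<in> A" "b \<in> B" for a b using col[OF that] .
  qed (use sub card_outside colors k not_three in auto)
qed


section \<open>Counting the vertices of the center\<close>

definition center :: "'v set \<Rightarrow> 'v set" where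
  "center S = {v \<in> S. \<forall>k\<in>{0, 1, 2}. label k v = big k}"

text \<open>Phrased through the center alone, so that the sets for the three colors can be compared.
  It agrees with \<open>poor_A\<close> and \<open>poor_B\<close> because a center vertex has no edge
  of color \<open>k\<close> to a vertex outside \<open>big k\<close>.\<close>

definition poor :: "'v set \<Rightarrow> 'v set \<Rightarrow> nat \<Rightarrow> 'v set" where
  "poor S T k = {v \<in> center S. card {w \<in> T. w \<notin> center T \<and> col v w = k} \<le> 1}"

lemma color_dichotomy:
  assumes k: "{k, d, d'} = {0, 1, 2}" "k \<noteq> d" "k \<noteq> d'" "d \<noteq> d'"
  shows "card (center B) + 3 \<le> card (poor A B k) + card (poor B A k) \<and>
      2 ^ (card (outside k B) - 1) \<le> card (poor A B k) \<or>
    card (center A) + 3 \<le> card (poor A B k) + card (poor B A k) \<and>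
      2 ^ (card (outside k A) - 1) \<le> card (poor B A k)"
proof -
  interpret m: main_color A B col k d d' "A - outside k A" "outside k A" "B - outside k B" "outside k B"
    "outside d' A" "outside d A" "outside d' B" "outside d B"
    by (rule main_color_outside[OF k])
  have cA: "m.A0 = center A" and cB: "m.B0 = center B"
    unfolding m.A0_def m.B0_def unfolding center_def outside_def k(1)[symmetric] by auto
  have colors: "k \<in> {0, 1, 2}" using k(1) by blast
  have *: "{w \<in> outside d' T \<union> outside d T. col v w = k} = {w \<in> T. w \<notin> center T \<and> col v w = k}"
    if v: "v \<in> center S" and ST: "S = A \<and> T = B \<or> S = B \<and> T = A" for v S T
  proof -
    have "w \<notin> outside k T" if "w \<in> T" "col v w = k" for w
      using ST label_edge[of v w k] label_edge[of w v k] v that col_commute[of v w] colors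
      by (auto simp: outside_def center_def)
    then show ?thesis
      unfolding center_def k(1)[symmetric] by (auto simp: outside_def)
  qed
  have pA: "m.poor_A = poor A B k"
    unfolding m.poor_A_def cA poor_def using *[of _ A B] by auto
  have pB: "m.poor_B = poor B A k"
    unfolding m.poor_B_def cB poor_def using *[of _ B A] by (auto simp: col_commute)
  show ?thesis using m.poor_dichotomy unfolding cA cB pA pB .
qed

text \<open>The vertices of the center see the at least three vertices of \<open>outside d' T\<close> in the colors \<open>k\<close> and \<open>d\<close> only.\<close>

lemma poor_disjoint:
  assumes k: "{k, d, d'} = {0, 1, 2}" "k \<noteq> d" "k \<noteq> d'" "d \<noteq> d'" and ST: "S = A \<and> T = B \<or> S = B \<and> T = A"
  shows "poor S T k \<inter> poor S T d = {}"
proof (rule ccontr)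
  assume "\<not> ?thesis"
  then obtain v where v: "v \<in> center S" and
    le: "card {w \<in> T. w \<notin> center T \<and> col v w = k} \<le> 1" "card {w \<in> T. w \<notin> center T \<and> col v w = d} \<le> 1"
    by (auto simp: poor_def)
  have colors: "d' \<in> {0, 1, 2}" using k(1) by blast
  have finT: "finite T" using ST fin_A fin_B by auto
  have "outside d' T \<subseteq> {w \<in> T. w \<notin> center T \<and> col v w = k} \<union> {w \<in> T. w \<notin> center T \<and> col v w = d}"
  proof
    fix w assume w: "w \<in> outside d' T"
    have "col v w \<noteq> d'"
      using ST label_edge[of v w d'] label_edge[of w v d'] v w col_commute[of v w] colors
      by (auto simp: outside_def center_def)
    moreover have "col v w \<in> {k, d, d'}"
      unfolding k(1) using ST v w col_range[of v w] col_range[of w v] col_commute[of v w]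
      by (auto simp: outside_def center_def)
    ultimately show "w \<in> {w \<in> T. w \<notin> center T \<and> col v w = k} \<union> {w \<in> T. w \<notin> center T \<and> col v w = d}"
      using w colors by (auto simp: outside_def center_def)
  qed
  then have "card (outside d' T) \<le> card ({w \<in> T. w \<notin> center T \<and> col v w = k} \<union> {w \<in> T. w \<notin> center T \<and> col v w = d})"
    using finT by (intro card_mono) auto
  also have "\<dots> \<le> 1 + 1"
    using card_Un_le le by (meson add_mono le_trans)
  finally show False using card_outside[of d' T] colors ST by auto
qed

lemma card_poor_sum:
  assumes ST: "S = A \<and> T = B \<or> S = B \<and> T = A"
  shows "card (poor S T 0) + card (poor S T 1) + card (poor S T 2) \<le> card (center S)"
proof -
  have fin: "finite (center S)" using ST fin_A fin_B by (auto simp: center_def)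
  have sub: "poor S T k \<subseteq> center S" for k by (auto simp: poor_def)
  have d: "poor S T 0 \<inter> poor S T 1 = {}" "poor S T 0 \<inter> poor S T 2 = {}" "poor S T 1 \<inter> poor S T 2 = {}"
    using poor_disjoint[of 0 1 2 S T] poor_disjoint[of 0 2 1 S T] poor_disjoint[of 1 2 0 S T] ST
    by (auto simp: insert_commute)
  have f: "finite (poor S T k)" for k using fin sub finite_subset by blast
  have "card (poor S T 0 \<union> poor S T 1 \<union> poor S T 2) = card (poor S T 0 \<union> poor S T 1) + card (poor S T 2)"
    by (rule card_Un_disjoint) (use d f in blast)+
  moreover have "card (poor S T 0 \<union> poor S T 1) = card (poor S T 0) + card (poor S T 1)"
    by (rule card_Un_disjoint) (use d f in blast)+
  ultimately have "card (poor S T 0 \<union> poor S T 1 \<union> poor S T 2) = card (poor S T 0) + card (poor S T 1) + card (poor S T 2)"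
    by simp
  moreover have "card (poor S T 0 \<union> poor S T 1 \<union> poor S T 2) \<le> card (center S)"
    using fin sub by (intro card_mono) auto
  ultimately show ?thesis by simp
qed

lemma card_split:
  assumes "S = A \<or> S = B"
  shows "card S = card (center S) + card (outside 0 S) + card (outside 1 S) + card (outside 2 S)"
proof -
  have fin: "finite S" using assms fin_A fin_B by auto
  have dis: "center S \<inter> outside 0 S = {}" "(center S \<union> outside 0 S) \<inter> outside 1 S = {}"
    "(center S \<union> outside 0 S \<union> outside 1 S) \<inter> outside 2 S = {}"
  proof -
    have "center S \<inter> outside k S = {}" if "k \<in> {0, 1, 2}" for k
      using that unfolding center_def outside_def by blast
    moreover have "outside 0 S \<inter> outside 1 S = {}" "outside 0 S \<inter> outside 2 S = {}" "outside 1 S \<inter> outside 2 S = {}"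
      using outside_disjoint assms by simp_all
    ultimately show "center S \<inter> outside 0 S = {}" "(center S \<union> outside 0 S) \<inter> outside 1 S = {}"
      "(center S \<union> outside 0 S \<union> outside 1 S) \<inter> outside 2 S = {}" by blast+
  qed
  have fins: "finite (center S)" "finite (outside k S)" for k
    using fin by (auto simp: center_def outside_def)
  have "S = center S \<union> outside 0 S \<union> outside 1 S \<union> outside 2 S"
    by (auto simp: center_def outside_def)
  then have "card S = card (center S \<union> outside 0 S \<union> outside 1 S \<union> outside 2 S)" by simp
  then show ?thesis
    using dis fins by (simp add: card_Un_disjoint)
qed

text \<open>Makes the exponential bound usable in linear arithmetic; equality holds at 3, the least
  guaranteed size of an \<open>outside\<close> set.\<close>

lemma power_bound: "3 \<le> x \<Longrightarrow> 2 * x \<le> (2 :: nat) ^ (x - 1) + 2"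
proof (induction x rule: dec_induct)
  case (step n)
  then obtain m where "n = Suc m" by (cases n) auto
  then show ?case using step by simp
qed simp

text \<open>Summed over the colors, a mixture of both alternatives already exceeds A0 + B0. If the
  first holds three times, 3 B0 + 9 \<le> A0 + B0, whereas balance and the power bounds give 2 A0 -
  2 B0 \<le> 2 (b0 + b1 + b2) \<le> A0 + 6, that is A0 \<le> 2 B0 + 6. The other uniform case is
  symmetric.\<close>

lemma counting_contradiction:
  fixes A0 B0 a0 a1 a2 b0 b1 b2 p0 p1 p2 q0 q1 q2 e0 e1 e2 f0 f1 f2 :: nat
  assumes "B0 + 3 \<le> p0 + q0 \<and> f0 \<le> p0 \<or> A0 + 3 \<le> p0 + q0 \<and> e0 \<le> q0"
    and "B0 + 3 \<le> p1 + q1 \<and> f1 \<le> p1 \<or> A0 + 3 \<le> p1 + q1 \<and> e1 \<le> q1"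
    and "B0 + 3 \<le> p2 + q2 \<and> f2 \<le> p2 \<or> A0 + 3 \<le> p2 + q2 \<and> e2 \<le> q2"
    and "p0 + p1 + p2 \<le> A0" "q0 + q1 + q2 \<le> B0" "A0 + a0 + a1 + a2 = B0 + b0 + b1 + b2"
    and "2 * a0 \<le> e0 + 2" "2 * a1 \<le> e1 + 2" "2 * a2 \<le> e2 + 2"
    and "2 * b0 \<le> f0 + 2" "2 * b1 \<le> f1 + 2" "2 * b2 \<le> f2 + 2"
  shows False
  using assms by (elim disjE conjE) linarith+

lemma no_big_components: False
proof -
  have perm: "{1, 2, 0 :: nat} = {0, 1, 2}" "{2, 0, 1 :: nat} = {0, 1, 2}" by auto
  have d0: "card (center B) + 3 \<le> card (poor A B 0) + card (poor B A 0) \<and> 2 ^ (card (outside 0 B) - 1) \<le> card (poor A B 0) \<or>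
      card (center A) + 3 \<le> card (poor A B 0) + card (poor B A 0) \<and> 2 ^ (card (outside 0 A) - 1) \<le> card (poor B A 0)"
    by (rule color_dichotomy[OF refl]) simp_all
  have d1: "card (center B) + 3 \<le> card (poor A B 1) + card (poor B A 1) \<and> 2 ^ (card (outside 1 B) - 1) \<le> card (poor A B 1) \<or>
      card (center A) + 3 \<le> card (poor A B 1) + card (poor B A 1) \<and> 2 ^ (card (outside 1 A) - 1) \<le> card (poor B A 1)"
    by (rule color_dichotomy[OF perm(1)]) simp_all
  have d2: "card (center B) + 3 \<le> card (poor A B 2) + card (poor B A 2) \<and> 2 ^ (card (outside 2 B) - 1) \<le> card (poor A B 2) \<or>
      card (center A) + 3 \<le> card (poor A B 2) + card (poor B A 2) \<and> 2 ^ (card (outside 2 A) - 1) \<le> card (poor B A 2)"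
    by (rule color_dichotomy[OF perm(2)]) simp_all
  have bal: "card (center A) + card (outside 0 A) + card (outside 1 A) + card (outside 2 A)
      = card (center B) + card (outside 0 B) + card (outside 1 B) + card (outside 2 B)"
    using card_split[of A] card_split[of B] balanced by simp
  have sums: "card (poor A B 0) + card (poor A B 1) + card (poor A B 2) \<le> card (center A)"
    "card (poor B A 0) + card (poor B A 1) + card (poor B A 2) \<le> card (center B)"
    by (rule card_poor_sum, simp)+
  have pw: "2 * card (outside k S) \<le> 2 ^ (card (outside k S) - 1) + 2" if "k \<in> {0, 1, 2}" "S = A \<or> S = B" for k S
    using card_outside[OF that] by (rule power_bound)
  have pws: "2 * card (outside 0 A) \<le> 2 ^ (card (outside 0 A) - 1) + 2" "2 * card (outside 1 A) \<le> 2 ^ (card (outside 1 A) - 1) + 2"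
    "2 * card (outside 2 A) \<le> 2 ^ (card (outside 2 A) - 1) + 2" "2 * card (outside 0 B) \<le> 2 ^ (card (outside 0 B) - 1) + 2"
    "2 * card (outside 1 B) \<le> 2 ^ (card (outside 1 B) - 1) + 2" "2 * card (outside 2 B) \<le> 2 ^ (card (outside 2 B) - 1) + 2"
    by (rule pw; simp)+
  show False by (rule counting_contradiction[OF d0 d1 d2 sums bal pws])
qed

end

text \<open>A vertex of A off \<open>x\<close> and a vertex of B off \<open>y\<close> can agree only
  in color \<open>k3\<close>, which forces a common label \<open>t1\<close>; exchanging the sides
  gives \<open>t2\<close>. If they are equal, this component completes \<open>x\<close> and
  \<open>y\<close> to a triple of which each vertex misses at most one; otherwise
  \<open>third_labels_equal\<close> applies.\<close>

lemma (in three_colored) no_pair_cover: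
  assumes k: "{k1, k2, k3} = {0, 1, 2}" "k1 \<noteq> k2" "k1 \<noteq> k3" "k2 \<noteq> k3"
    and cov: "\<And>v. v \<in> A \<union> B \<Longrightarrow> label k1 v = x \<or> label k2 v = y" and bal: "card A = card B"
  shows False
proof -
  have colors: "k1 \<in> {0, 1, 2}" "k2 \<in> {0, 1, 2}" "k3 \<in> {0, 1, 2}" using k(1) by blast+
  have agree: "label k1 a = label k1 b \<or> label k2 a = label k2 b \<or> label k3 a = label k3 b" if "a \<in> A" "b \<in> B" for a b
  proof -
    have "col a b \<in> {k1, k2, k3}" using col_range[OF that] k(1) by simp
    then show ?thesis using label_edge[OF that] by auto
  qed
  obtain a where a: "a \<in> A" "label k1 a \<noteq> x" using manyD[OF many_labels(1)[OF colors(1)]] by metis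
  obtain b where b: "b \<in> B" "label k2 b \<noteq> y" using manyD[OF many_labels(2)[OF colors(2)]] by metis
  obtain a' where a': "a' \<in> A" "label k2 a' \<noteq> y" using manyD[OF many_labels(1)[OF colors(2)]] by metis
  obtain b' where b': "b' \<in> B" "label k1 b' \<noteq> x" using manyD[OF many_labels(2)[OF colors(1)]] by metis
  define t1 where "t1 = label k3 a"
  define t2 where "t2 = label k3 a'"
  have eq: "label k3 u = label k3 v" if "u \<in> A" "v \<in> B" "label k1 u \<noteq> x" "label k2 v \<noteq> y" for u v
    using agree[OF that(1,2)] cov[of u] cov[of v] that by (metis UnI1 UnI2)
  have eq': "label k3 u = label k3 v" if "u \<in> A" "v \<in> B" "label k2 u \<noteq> y" "label k1 v \<noteq> x" for u v
    using agree[OF that(1,2)] cov[of u] cov[of v] that by (metis UnI1 UnI2)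
  have tB: "label k3 v = t1" if "v \<in> B" "label k2 v \<noteq> y" for v
    using eq[OF a(1) that(1) a(2) that(2)] by (simp add: t1_def)
  have tA: "label k3 u = t1" if "u \<in> A" "label k1 u \<noteq> x" for u
    using eq[OF that(1) b(1) that(2) b(2)] tB[OF b] by simp
  have tB': "label k3 v = t2" if "v \<in> B" "label k1 v \<noteq> x" for v
    using eq'[OF a'(1) that(1) a'(2) that(2)] by (simp add: t2_def)
  have tA': "label k3 u = t2" if "u \<in> A" "label k2 u \<noteq> y" for u
    using eq'[OF that(1) b'(1) that(2) b'(2)] tB'[OF b'] by simp
  show False
  proof (cases "t1 = t2")
    case False
    then show False using third_labels_equal[OF k cov tA tB tA' tB'] by blast
  next
    case True
    define big where "big k = (if k = k1 then x else if k = k2 then y else t1)" for k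
    interpret bg: big_components A B col big
    proof unfold_locales
      fix v k k' :: _
      assume v: "v \<in> A \<union> B" and kk: "k \<in> {0, 1, 2 :: nat}" "k' \<in> {0, 1, 2 :: nat}" "k \<noteq> k'"
      define P where "P j \<longleftrightarrow> label j v = big j" for j
      have "label k1 v = x \<or> label k2 v = y" by (rule cov[OF v])
      moreover have "label k1 v = x \<or> label k3 v = t1" using v tA tB' True by blast
      moreover have "label k2 v = y \<or> label k3 v = t1" using v tA' tB True by blast
      moreover have "k \<in> {k1, k2, k3}" "k' \<in> {k1, k2, k3}" using kk k(1) by simp_all
      moreover have "big k1 = x" "big k2 = y" "big k3 = t1" using k by (simp_all add: big_def)
      ultimately have "P k \<or> P k'" unfolding P_def using kk(3) by (metis empty_iff insert_iff)
      then show "label k v = big k \<or> label k' v = big k'" by (simp only: P_def)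
    qed (rule bal)
    show False by (rule bg.no_big_components)
  qed
qed

lemma (in bipartite_coloring) three_parts_exist:
  assumes "\<And>a b. a \<in> A \<Longrightarrow> b \<in> B \<Longrightarrow> col a b \<in> {0, 1, 2}"
    and "\<And>a k. a \<in> A \<Longrightarrow> k \<in> {0, 1, 2} \<Longrightarrow> \<exists>b\<in>B. col a b = k"
    and "\<And>b k. b \<in> B \<Longrightarrow> k \<in> {0, 1, 2} \<Longrightarrow> \<exists>a\<in>A. col a b = k"
    and bal: "card A = card B"
  shows "three_parts A B col"
proof (rule ccontr)
  assume "\<not> three_parts A B col"
  then interpret three_colored A B col using assms by unfold_locales auto
  interpret labels A B "label 0" "label 1" "label 2" by (rule labels_label)
  have perm: "{0, 2, 1 :: nat} = {0, 1, 2}" "{1, 2, 0 :: nat} = {0, 1, 2}" by auto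
  obtain x y where "(\<forall>v\<in>A \<union> B. label 0 v = x \<or> label 1 v = y) \<or> (\<forall>v\<in>A \<union> B. label 0 v = x \<or> label 2 v = y)
      \<or> (\<forall>v\<in>A \<union> B. label 1 v = x \<or> label 2 v = y)"
    using pair_cover_both unfolding pair_cover_def by blast
  then show False
  proof (elim disjE)
    assume c: "\<forall>v\<in>A \<union> B. label 0 v = x \<or> label 1 v = y"
    show False by (rule no_pair_cover[OF refl _ _ _ bspec[OF c] bal]) simp_all
  next
    assume c: "\<forall>v\<in>A \<union> B. label 0 v = x \<or> label 2 v = y"
    show False by (rule no_pair_cover[OF perm(1) _ _ _ bspec[OF c] bal]) simp_all
  next
    assume c: "\<forall>v\<in>A \<union> B. label 1 v = x \<or> label 2 v = y"
    show False by (rule no_pair_cover[OF perm(2) _ _ _ bspec[OF c] bal]) simp_all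
  qed
qed

section \<open>Trees and the extremal coloring\<close>

lemma walk_mono:
  "is_walk (V, F) p \<Longrightarrow> V \<subseteq> V' \<Longrightarrow> F \<subseteq> F' \<Longrightarrow> is_walk (V', F') p"
  unfolding is_walk_def verts_def edges_def by (auto elim!: successively_mono)

lemma walk_snoc:
  assumes "is_walk (V, F) p" "last p = w" "{w, v} \<in> F" "v \<in> V"
  shows "is_walk (V, F) (p @ [v])"
  using assms unfolding is_walk_def by (auto simp: verts_def edges_def successively_append_iff)

lemma walk_Cons:
  assumes "is_walk (V, F) p" "hd p = w" "{w, v} \<in> F" "v \<in> V"
  shows "is_walk (V, F) (v # p)"
  using assms unfolding is_walk_def by (cases p) (auto simp: verts_def edges_def insert_commute)

text \<open>This keeps leaves off cycles. The cyclic order wraps around at both ends of the list,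
  and length at least three keeps the two neighbours distinct.\<close>

lemma cycle_neighbours:
  assumes "is_cycle (V, F) p" "v \<in> set p"
  shows "\<exists>x y. x \<noteq> y \<and> {x, v} \<in> F \<and> {y, v} \<in> F"
proof -
  have p: "distinct p" "length p \<ge> 3" "{last p, hd p} \<in> F" "p \<noteq> []"
    and e: "\<And>i. Suc i < length p \<Longrightarrow> {p ! i, p ! Suc i} \<in> F"
    using assms(1) by (auto simp: is_cycle_def is_walk_def edges_def successively_conv_nth)
  obtain i where i: "i < length p" "p ! i = v" using assms(2) by (auto simp: in_set_conv_nth)
  have l: "last p = p ! (length p - 1)" "hd p = p ! 0"
    using p by (simp_all add: last_conv_nth hd_conv_nth)
  consider "i = 0" | "i = length p - 1" "i \<noteq> 0" | "i \<noteq> 0" "Suc i < length p" using i by linarith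
  then show ?thesis
  proof cases
    case 1
    have "{p ! 1, v} \<in> F" using e[of 0] 1 i p by (simp add: insert_commute)
    moreover have "{last p, v} \<in> F" using p(3) l i 1 by simp
    moreover have "p ! 1 \<noteq> last p" using p l by (simp add: nth_eq_iff_index_eq)
    ultimately show ?thesis by blast
  next
    case 2
    have "{p ! (i - 1), v} \<in> F" using e[of "i - 1"] 2(2) i by simp
    moreover have "{hd p, v} \<in> F" using p(3) l i 2 by (simp add: insert_commute)
    moreover have "p ! (i - 1) \<noteq> hd p" using p l 2 i by (simp add: nth_eq_iff_index_eq)
    ultimately show ?thesis by blast
  next
    case 3
    have "{p ! (i - 1), v} \<in> F" using e[of "i - 1"] 3 i by simp
    moreover have "{p ! Suc i, v} \<in> F" using e[of i] 3 i by (simp add: insert_commute)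
    moreover have "p ! (i - 1) \<noteq> p ! Suc i" using p 3 i by (simp add: nth_eq_iff_index_eq)
    ultimately show ?thesis by blast
  qed
qed

text \<open>A cycle through \<open>v\<close> would need two neighbours of \<open>v\<close>, but
  \<open>w\<close> is the only one; a cycle avoiding \<open>v\<close> uses old edges only.\<close>

lemma is_tree_insert_leaf:
  assumes T: "is_tree (V, F)" and w: "w \<in> V" and v: "v \<notin> V"
  shows "is_tree (insert v V, insert {w, v} F)"
proof -
  have simple: "finite V" "\<And>e. e \<in> F \<Longrightarrow> \<exists>x\<in>V. \<exists>y\<in>V. x \<noteq> y \<and> e = {x, y}"
    and con: "\<And>x y. x \<in> V \<Longrightarrow> y \<in> V \<Longrightarrow> \<exists>p. is_walk (V, F) p \<and> hd p = x \<and> last p = y"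
    and acyclic: "\<And>p. \<not> is_cycle (V, F) p"
    using T by (auto simp: is_tree_def simple_graph_def connected_graph_def verts_def edges_def)
  let ?V = "insert v V" and ?F = "insert {w, v} F"
  have F_V: "e \<subseteq> V" if "e \<in> F" for e using simple(2)[OF that] by blast
  have "simple_graph (?V, ?F)"
    unfolding simple_graph_def verts_def edges_def
  proof (simp only: fst_conv snd_conv, intro conjI ballI)
    show "finite ?V" using simple(1) by simp
    fix e assume "e \<in> ?F"
    then consider "e = {w, v}" | "e \<in> F" by blast
    then show "\<exists>x\<in>?V. \<exists>y\<in>?V. x \<noteq> y \<and> e = {x, y}"
    proof cases
      case 1
      then show ?thesis using w v by (intro bexI[of _ w] bexI[of _ v]) auto
    next
      case 2
      then show ?thesis using simple(2)[of e] by blast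
    qed
  qed
  moreover have "connected_graph (?V, ?F)"
    unfolding connected_graph_def
  proof (intro conjI ballI)
    show "verts (?V, ?F) \<noteq> {}" by (simp add: verts_def)
    fix x y assume "x \<in> verts (?V, ?F)" "y \<in> verts (?V, ?F)"
    then have xy: "x \<in> ?V" "y \<in> ?V" by (simp_all add: verts_def)
    have walk: "\<exists>p. is_walk (?V, ?F) p \<and> hd p = x \<and> last p = y" if "x \<in> V" "y \<in> V" for x y
      using con[OF that] walk_mono[of V F _ ?V ?F] by blast
    consider "x \<in> V" "y \<in> V" | "x \<in> V" "y = v" | "x = v" "y \<in> V" | "x = v" "y = v" using xy by blast
    then show "\<exists>p. is_walk (?V, ?F) p \<and> hd p = x \<and> last p = y"
    proof cases
      case 1
      then show ?thesis by (rule walk)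
    next
      case 2
      obtain p where p: "is_walk (?V, ?F) p" "hd p = x" "last p = w" using walk[OF 2(1) w] by blast
      then have "is_walk (?V, ?F) (p @ [v])" by (intro walk_snoc) auto
      then show ?thesis using p 2 by (intro exI[of _ "p @ [v]"]) (auto simp: is_walk_def)
    next
      case 3
      obtain p where p: "is_walk (?V, ?F) p" "hd p = w" "last p = y" using walk[OF w 3(2)] by blast
      then have "is_walk (?V, ?F) (v # p)" by (intro walk_Cons) auto
      then show ?thesis using p 3 by (intro exI[of _ "v # p"]) (auto simp: is_walk_def)
    next
      case 4
      then show ?thesis by (intro exI[of _ "[v]"]) (simp add: is_walk_def verts_def)
    qed
  qed
  moreover have "\<not> is_cycle (?V, ?F) p" for p
  proof
    assume c: "is_cycle (?V, ?F) p"
    show False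
    proof (cases "v \<in> set p")
      case True
      then obtain x y where xy: "x \<noteq> y" "{x, v} \<in> ?F" "{y, v} \<in> ?F" using cycle_neighbours[OF c] by blast
      have "z = w" if "{z, v} \<in> ?F" for z
        using that F_V v w by (auto simp: doubleton_eq_iff)
      then show False using xy by blast
    next
      case False
      have F: "{x, y} \<in> F" if "{x, y} \<in> ?F" "x \<in> set p" "y \<in> set p" for x y
        using that False by (auto simp: doubleton_eq_iff)
      have p: "p \<noteq> []" "set p \<subseteq> ?V" "distinct p" "length p \<ge> 3" "{last p, hd p} \<in> ?F"
        and e: "successively (\<lambda>x y. {x, y} \<in> ?F) p"
        using c by (simp_all add: is_cycle_def is_walk_def verts_def edges_def)
      have "successively (\<lambda>x y. {x, y} \<in> F) p"
        unfolding successively_conv_nth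
      proof (intro allI impI)
        fix i assume "Suc i < length p"
        then show "{p ! i, p ! Suc i} \<in> F"
          using e by (intro F) (simp_all add: successively_conv_nth)
      qed
      moreover have "{last p, hd p} \<in> F" using p by (intro F) simp_all
      moreover have "set p \<subseteq> V" using p(2) False by blast
      ultimately have "is_cycle (V, F) p"
        using p by (simp add: is_cycle_def is_walk_def verts_def edges_def)
      then show False using acyclic by blast
    qed
  qed
  ultimately show ?thesis by (simp add: is_tree_def)
qed

lemma is_tree_singleton: "is_tree ({v}, {})"
proof -
  have "\<exists>p. is_walk ({v}, {}) p \<and> hd p = v \<and> last p = v"
    by (rule exI[of _ "[v]"]) (simp add: is_walk_def verts_def)
  then show ?thesis
    by (auto simp: is_tree_def simple_graph_def connected_graph_def verts_def edges_def is_cycle_def)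
qed

text \<open>A largest tree inside S with edges from E spans S, since an edge across the cut would
  add a leaf. Here the cut condition is converted into walks and acyclicity.\<close>

lemma conn_spanning_tree:
  assumes S: "conn E S" "finite S"
  shows "\<exists>F. is_tree (S, F) \<and> (\<forall>e\<in>F. \<exists>u v. E u v \<and> e = {u, v})"
proof -
  define good where "good = (\<lambda>(V, F). V \<subseteq> S \<and> is_tree (V, F) \<and> (\<forall>e\<in>F. \<exists>u v. E u v \<and> e = {u, v}))"
  obtain u where "u \<in> S" using S(1) by (auto simp: conn_def)
  then have "good ({u}, {})" using is_tree_singleton by (simp add: good_def)
  moreover have "\<forall>t. good t \<longrightarrow> card (fst t) < Suc (card S)"
    using S(2) by (auto simp: good_def less_Suc_eq_le intro: card_mono)
  ultimately obtain t where "good t" and max: "\<And>t'. good t' \<Longrightarrow> card (fst t') \<le> card (fst t)"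
    using ex_has_greatest_nat[of good _ "\<lambda>t. card (fst t)" "Suc (card S)"] by blast
  then obtain V F where t: "t = (V, F)" "V \<subseteq> S" "is_tree (V, F)" "\<forall>e\<in>F. \<exists>u v. E u v \<and> e = {u, v}"
    by (cases t) (auto simp: good_def)
  have "V = S"
  proof (rule ccontr)
    assume "V \<noteq> S"
    moreover have "V \<noteq> {}" using t(3) by (auto simp: is_tree_def connected_graph_def verts_def)
    ultimately obtain w v where wv: "w \<in> V" "v \<in> S - V" "E w v" using connD[OF S(1) t(2)] by blast
    have "good (insert v V, insert {w, v} F)"
      using is_tree_insert_leaf[OF t(3) wv(1)] wv t by (auto simp: good_def)
    then have "card (insert v V) \<le> card V" using max t(1) by fastforce
    then show False using wv t(2) S(2) by (simp add: finite_subset)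
  qed
  then show ?thesis using t by blast
qed


section \<open>From colored complete bipartite graphs to partitions into trees\<close>

lemma edges_complete_bipartite:
  "{Inl i, Inr j} \<in> edges (complete_bipartite m n) \<longleftrightarrow> i < m \<and> j < n"
  by (auto simp: complete_bipartite_def edges_def doubleton_eq_iff)

lemma edge_complete_bipartite_cases:
  assumes "e \<in> edges (complete_bipartite m n)"
  obtains i j where "e = {Inl i, Inr j}" "i < m" "j < n"
  using assms by (auto simp: complete_bipartite_def edges_def)

lemma verts_complete_bipartite: "verts (complete_bipartite m n) = Inl ` {..<m} \<union> Inr ` {..<n}"
  by (simp add: complete_bipartite_def verts_def)

lemma simple_complete_bipartite: "simple_graph (complete_bipartite m n)"
  unfolding simple_graph_def verts_complete_bipartite
proof (intro conjI ballI)
  fix e assume "e \<in> edges (complete_bipartite m n)"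
  then obtain i j where "e = {Inl i, Inr j}" "i < m" "j < n" by (rule edge_complete_bipartite_cases)
  then show "\<exists>u\<in>Inl ` {..<m} \<union> Inr ` {..<n}. \<exists>v\<in>Inl ` {..<m} \<union> Inr ` {..<n}. u \<noteq> v \<and> e = {u, v}"
    by (intro bexI[of _ "Inl i"] bexI[of _ "Inr j"]) auto
qed simp

lemma full_degree_colors:
  assumes "edge_coloring 3 G c" "color_degree G c v = 3" "k \<in> {0, 1, 2}"
  shows "\<exists>e\<in>edges G. v \<in> e \<and> c e = k"
proof -
  have sub: "c ` {e \<in> edges G. v \<in> e} \<subseteq> {0, 1, 2}"
    using assms(1) by (force simp: edge_coloring_def)
  moreover have "card {0, 1, 2 :: nat} = 3" by simp
  ultimately have "c ` {e \<in> edges G. v \<in> e} = {0, 1, 2}"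
    using assms(2) by (intro card_subset_eq) (simp_all add: color_degree_def)
  then have "k \<in> c ` {e \<in> edges G. v \<in> e}" using assms(3) by simp
  then show ?thesis by auto
qed

lemma mono_tree_of_conn:
  assumes S: "conn (adj (Inl ` {..<n}) (Inr ` {..<n}) (\<lambda>u v. c {u, v}) k) S"
    and sub: "S \<subseteq> verts (complete_bipartite n n)"
  shows "\<exists>T. mono_tree (complete_bipartite n n) c T \<and> verts T = S"
proof -
  have "finite S" using sub by (rule finite_subset) (simp add: verts_complete_bipartite)
  then obtain F where F: "is_tree (S, F)"
    "\<And>e. e \<in> F \<Longrightarrow> \<exists>u v. adj (Inl ` {..<n}) (Inr ` {..<n}) (\<lambda>u v. c {u, v}) k u v \<and> e = {u, v}"
    using conn_spanning_tree[OF S] by blast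
  have F': "e \<in> edges (complete_bipartite n n) \<and> c e = k" if "e \<in> F" for e
    using F(2)[OF that] by (auto simp: adj_def edges_complete_bipartite insert_commute)
  have "mono_tree (complete_bipartite n n) c (S, F)"
    unfolding mono_tree_def subgraph_def
  proof (intro conjI)
    show "simple_graph (S, F)" using F(1) by (simp add: is_tree_def)
    show "verts (S, F) \<subseteq> verts (complete_bipartite n n)" using sub by (simp add: verts_def)
    show "edges (S, F) \<subseteq> edges (complete_bipartite n n)" using F' by (auto simp: edges_def)
    show "\<exists>k. \<forall>e\<in>edges (S, F). c e = k" using F' by (auto simp: edges_def)
  qed (use F(1) simple_complete_bipartite in simp_all)
  then show ?thesis by (intro exI[of _ "(S, F)"]) (simp add: verts_def)
qed

lemma partition_into_three:
  assumes c: "c \<in> full_degree_colorings 3 (complete_bipartite n n)"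
  shows "\<exists>\<T>. mono_tree_partition (complete_bipartite n n) c \<T> \<and> card \<T> \<le> 3"
proof -
  let ?G = "complete_bipartite n n" and ?A = "Inl ` {..<n} :: (nat + nat) set" and ?B = "Inr ` {..<n} :: (nat + nat) set"
  let ?col = "\<lambda>u v. c {u, v}"
  have col: "edge_coloring 3 ?G c" and deg: "\<And>v. v \<in> ?A \<union> ?B \<Longrightarrow> color_degree ?G c v = 3"
    using c by (auto simp: full_degree_colorings_def verts_complete_bipartite)
  interpret bipartite_coloring ?A ?B ?col
    by unfold_locales (auto simp: insert_commute)
  have "three_parts ?A ?B ?col"
  proof (rule three_parts_exist)
    show "c {a, b} \<in> {0, 1, 2}" if "a \<in> ?A" "b \<in> ?B" for a b
    proof -
      have "{a, b} \<in> edges ?G" using that by (auto simp: edges_complete_bipartite)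
      then have "c {a, b} < 3" using col by (simp add: edge_coloring_def)
      then show ?thesis by auto
    qed
    show "\<exists>b\<in>?B. c {a, b} = k" if a: "a \<in> ?A" and k: "k \<in> {0, 1, 2}" for a k
    proof -
      obtain e where e: "e \<in> edges ?G" "a \<in> e" "c e = k" using full_degree_colors[OF col deg k] a by blast
      obtain i j where "e = {Inl i, Inr j}" "i < n" "j < n" using e(1) by (rule edge_complete_bipartite_cases)
      then show ?thesis using e a by auto
    qed
    show "\<exists>a\<in>?A. c {a, b} = k" if b: "b \<in> ?B" and k: "k \<in> {0, 1, 2}" for b k
    proof -
      obtain e where e: "e \<in> edges ?G" "b \<in> e" "c e = k" using full_degree_colors[OF col deg k] b by blast
      obtain i j where "e = {Inl i, Inr j}" "i < n" "j < n" using e(1) by (rule edge_complete_bipartite_cases)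
      then show ?thesis using e b by auto
    qed
    show "card ?A = card ?B" by (simp add: card_image)
  qed
  then obtain S T U where parts: "?A \<union> ?B = S \<union> T \<union> U" "S \<inter> T = {}" "S \<inter> U = {}" "T \<inter> U = {}"
    and "monochromatic ?A ?B ?col S" "monochromatic ?A ?B ?col T" "monochromatic ?A ?B ?col U"
    unfolding three_parts_def by (elim exE conjE) (rule that)
  then have mono: "monochromatic ?A ?B ?col W" if "W \<in> {S, T, U}" for W using that by blast
  \<comment> \<open>Trees are nonempty, so empty parts are dropped, which only lowers their
    number.\<close>
  define \<W> where "\<W> = {S, T, U} - {{}}"
  have "\<exists>t. mono_tree ?G c t \<and> verts t = W" if W: "W \<in> \<W>" for W
  proof -
    obtain k where "conn (adj ?A ?B ?col k) W"
      using mono[of W] W by (auto simp: \<W>_def monochromatic_def)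
    moreover have "W \<subseteq> verts ?G" using W parts(1) by (auto simp: \<W>_def verts_complete_bipartite)
    ultimately show ?thesis by (rule mono_tree_of_conn)
  qed
  then obtain t where t: "\<And>W. W \<in> \<W> \<Longrightarrow> mono_tree ?G c (t W) \<and> verts (t W) = W" by metis
  have "mono_tree_partition ?G c (t ` \<W>)"
    unfolding mono_tree_partition_def
  proof (intro conjI ballI impI)
    show "finite (t ` \<W>)" by (simp add: \<W>_def)
    show "mono_tree ?G c x" if "x \<in> t ` \<W>" for x using that t by blast
    show "verts x \<inter> verts y = {}" if xy: "x \<in> t ` \<W>" "y \<in> t ` \<W>" "x \<noteq> y" for x y
    proof -
      obtain V W where VW: "x = t V" "y = t W" "V \<in> \<W>" "W \<in> \<W>" "V \<noteq> W" using xy by blast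
      then have "V \<inter> W = {}"
        using parts(2-4) unfolding \<W>_def by (metis DiffD1 Int_commute empty_iff insertE)
      then show ?thesis using t VW by simp
    qed
    have "(\<Union>x\<in>t ` \<W>. verts x) = \<Union>\<W>" using t by auto
    also have "\<dots> = S \<union> T \<union> U" by (auto simp: \<W>_def)
    finally show "(\<Union>x\<in>t ` \<W>. verts x) = verts ?G" using parts(1) by (simp add: verts_complete_bipartite)
  qed
  moreover have "card (t ` \<W>) \<le> 3"
  proof -
    have "card (t ` \<W>) \<le> card \<W>" by (rule card_image_le) (simp add: \<W>_def)
    also have "\<dots> \<le> card {S, T, U}" by (rule card_mono) (auto simp: \<W>_def)
    also have "\<dots> \<le> 3" by (simp add: card_insert_if)
    finally show ?thesis .
  qed
  ultimately show ?thesis by blast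
qed

text \<open>Blow-up of the Latin square of order three: both sides are split into three classes, and each
  monochromatic tree meets only one class of each side.\<close>

definition class_of :: "nat + nat \<Rightarrow> nat" where
  "class_of v = min (case_sum id id v) 2"

text \<open>The Latin square is the addition table modulo 3. Summing over the edge as a set is
  harmless, since \<open>Inl i\<close> and \<open>Inr j\<close> are distinct even if i = j.\<close>

definition blowup :: "(nat + nat) set \<Rightarrow> nat" where
  "blowup e = (\<Sum>v\<in>e. class_of v) mod 3"

lemma blowup_edge: "blowup {Inl i, Inr j} = (min i 2 + min j 2) mod 3"
  by (simp add: blowup_def class_of_def)

lemma blowup_full_degree:
  assumes "n \<ge> 3"
  shows "blowup \<in> full_degree_colorings 3 (complete_bipartite n n)"
proof -
  let ?G = "complete_bipartite n n"
  have "color_degree ?G blowup v = 3" if v: "v \<in> verts ?G" for v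
  proof -
    have lt: "blowup ` {e \<in> edges ?G. v \<in> e} \<subseteq> {0, 1, 2}"
      by (auto simp: blowup_def)
    moreover have "k \<in> blowup ` {e \<in> edges ?G. v \<in> e}" if k: "k \<in> {0, 1, 2}" for k
    proof -
      \<comment> \<open>The class needed at the other end; as j < 3 \<le> n, it is also the index of
        a vertex of that class. Adding 3 prevents truncated subtraction.\<close>
      define j where "j = (k + 3 - class_of v) mod 3"
      have j: "j < 3" by (simp add: j_def)
      have cv: "class_of v \<le> 2" by (simp add: class_of_def)
      have eq: "(class_of v + j) mod 3 = k"
      proof -
        have "(class_of v + j) mod 3 = (class_of v + (k + 3 - class_of v)) mod 3"
          by (simp add: j_def mod_add_right_eq)
        also have "\<dots> = k" using cv k by auto
        finally show ?thesis .
      qed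
      have minj: "min j 2 = j" using j by simp
      show ?thesis
      proof (cases v)
        case (Inl i)
        have "{Inl i, Inr j} \<in> edges ?G" using v Inl j assms by (auto simp: edges_complete_bipartite verts_complete_bipartite)
        moreover have "blowup {Inl i, Inr j} = k" using eq minj Inl by (simp add: blowup_edge class_of_def)
        ultimately show ?thesis using Inl by force
      next
        case (Inr i)
        have "{Inl j, Inr i} \<in> edges ?G" using v Inr j assms by (auto simp: edges_complete_bipartite verts_complete_bipartite)
        moreover have "blowup {Inl j, Inr i} = k" using eq minj Inr by (simp add: blowup_edge class_of_def add.commute)
        ultimately show ?thesis using Inr by force
      qed
    qed
    ultimately have "blowup ` {e \<in> edges ?G. v \<in> e} = {0, 1, 2}" by blast
    then show ?thesis by (simp add: color_degree_def)
  qed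
  then show ?thesis by (auto simp: full_degree_colorings_def edge_coloring_def blowup_def)
qed

text \<open>Along an edge of color \<open>k\<close> the classes add up to \<open>k\<close> modulo 3,
  so the class of one end determines that of the other. The function \<open>h\<close> records for
  every vertex the left class compatible with it, and is therefore constant along walks of
  T.\<close>

lemma blowup_tree_class:
  assumes T: "mono_tree (complete_bipartite n n) blowup T" and "Inl i \<in> verts T" "Inl i' \<in> verts T"
  shows "min i 2 = min i' 2"
proof -
  obtain k where k: "\<And>e. e \<in> edges T \<Longrightarrow> blowup e = k" and sub: "edges T \<subseteq> edges (complete_bipartite n n)"
    using T by (auto simp: mono_tree_def subgraph_def)
  define h where "h v = (case v of Inl i \<Rightarrow> min i 2 | Inr j \<Rightarrow> (k + 3 - min j 2) mod 3)" for v :: "nat + nat"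
  have edge: "min i 2 = (k + 3 - min j 2) mod 3" if "blowup {Inl i, Inr j} = k" for i j :: nat
  proof -
    have cases: "min x 2 = 0 \<or> min x 2 = 1 \<or> min x 2 = 2" for x :: nat by auto
    show ?thesis using that cases[of i] cases[of j] unfolding blowup_edge by (elim disjE) auto
  qed
  have h: "h u = h v" if uv: "{u, v} \<in> edges T" for u v
  proof -
    have "{u, v} \<in> edges (complete_bipartite n n)" using uv sub by blast
    then obtain i j where ij: "{u, v} = {Inl i, Inr j}" by (rule edge_complete_bipartite_cases)
    then have "h (Inl i) = h (Inr j)" using k[OF uv] edge[of i j] by (simp add: h_def)
    then show ?thesis using ij by (auto simp: doubleton_eq_iff)
  qed
  have walk: "h (hd p) = h (last p)" if "is_walk T p" for p
  proof -
    have "p \<noteq> [] \<Longrightarrow> successively (\<lambda>u v. {u, v} \<in> edges T) p \<Longrightarrow> h (hd p) = h (last p)"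
    proof (induction p)
      case (Cons a p)
      show ?case
      proof (cases p)
        case p: (Cons b q)
        have "h a = h b" using Cons.prems p by (intro h) simp
        then show ?thesis using Cons p by simp
      qed simp
    qed simp
    then show ?thesis using that by (simp add: is_walk_def)
  qed
  obtain p where "is_walk T p" "hd p = Inl i" "last p = Inl i'"
    using T assms(2,3) unfolding mono_tree_def is_tree_def connected_graph_def by blast
  then show ?thesis using walk[of p] by (simp add: h_def)
qed

lemma blowup_needs_three:
  assumes "n \<ge> 3" and P: "mono_tree_partition (complete_bipartite n n) blowup \<T>"
  shows "3 \<le> card \<T>"
proof -
  have "\<exists>T\<in>\<T>. Inl i \<in> verts T" if "i < 3" for i
  proof -
    have "Inl i \<in> verts (complete_bipartite n n)" using that assms(1) by (auto simp: verts_complete_bipartite)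
    then show ?thesis using P by (auto simp: mono_tree_partition_def)
  qed
  then obtain t where t: "\<And>i. i < 3 \<Longrightarrow> t i \<in> \<T> \<and> Inl i \<in> verts (t i)" by metis
  have "inj_on t {..<3}"
  proof (rule inj_onI)
    fix i j :: nat assume ij: "i \<in> {..<3}" "j \<in> {..<3}" "t i = t j"
    then have *: "Inl i \<in> verts (t i)" "Inl j \<in> verts (t i)" "t i \<in> \<T>" using t[of i] t[of j] by auto
    then have "mono_tree (complete_bipartite n n) blowup (t i)" using P by (simp add: mono_tree_partition_def)
    then have "min i 2 = min j 2" using blowup_tree_class * by blast
    then show "i = j" using ij by auto
  qed
  then have "card (t ` {..<3}) = 3" by (simp add: card_image)
  moreover have "t ` {..<3} \<subseteq> \<T>" using t by auto
  moreover have "finite \<T>" using P by (simp add: mono_tree_partition_def)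
  ultimately show ?thesis using card_mono by metis
qed

theorem theorem7:
  fixes n :: nat
  assumes "n \<ge> 3"
  shows "(\<forall>c\<in>full_degree_colorings 3 (complete_bipartite n n).
            \<exists>\<T>. mono_tree_partition (complete_bipartite n n) c \<T> \<and> card \<T> \<le> 3)
       \<and> (\<exists>c\<in>full_degree_colorings 3 (complete_bipartite n n).
            \<nexists>\<T>. mono_tree_partition (complete_bipartite n n) c \<T> \<and> card \<T> < 3)
       \<and> tree_partition_number (complete_bipartite n n)
            (full_degree_colorings 3 (complete_bipartite n n)) = 3"
proof (intro conjI ballI)
  show upper: "\<exists>\<T>. mono_tree_partition (complete_bipartite n n) c \<T> \<and> card \<T> \<le> 3"
    if "c \<in> full_degree_colorings 3 (complete_bipartite n n)" for c
    using that by (rule partition_into_three)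
  have low: "3 \<le> card \<T>" if "mono_tree_partition (complete_bipartite n n) blowup \<T>" for \<T>
    using assms that by (rule blowup_needs_three)
  have mem: "blowup \<in> full_degree_colorings 3 (complete_bipartite n n)"
    using assms by (rule blowup_full_degree)
  show "\<exists>c\<in>full_degree_colorings 3 (complete_bipartite n n).
      \<nexists>\<T>. mono_tree_partition (complete_bipartite n n) c \<T> \<and> card \<T> < 3"
    using mem low by (meson not_less)
  show "tree_partition_number (complete_bipartite n n) (full_degree_colorings 3 (complete_bipartite n n)) = 3"
    unfolding tree_partition_number_def
  proof (rule Least_equality)
    show "\<forall>c\<in>full_degree_colorings 3 (complete_bipartite n n).
        \<exists>\<T>. mono_tree_partition (complete_bipartite n n) c \<T> \<and> card \<T> \<le> 3"
      using upper by blast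
    fix m assume "\<forall>c\<in>full_degree_colorings 3 (complete_bipartite n n).
        \<exists>\<T>. mono_tree_partition (complete_bipartite n n) c \<T> \<and> card \<T> \<le> m"
    then show "3 \<le> m" using mem low by (meson le_trans)
  qed
qed

end
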